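(* Let $K=A\cup B\subset\mathbb C^2$, $H\subset\mathbb C$, $\Phi$ and $b$ be as in the context, $a=(0,3)$, $\tau>0$, $\psi_\tau=\tau\Phi|_K$, $F_\delta=V_{\delta,K,\psi_\tau}^*$, and $$\kappa_\tau=\frac{\tau\log(26/25)}{2\log5}.$$ For every $h>0$, $$\min\{h,\kappa_\tau\}V_H^*(3)\le F_{\tau+h}(a)-\psi_\tau(a)\le hV_H^*(3).$$ In particular, $$F_{\tau+h}(a)=\psi_\tau(a)+hV_H^*(3)\qquad(0\le h\le\kappa_\tau),$$ and, with $D_\tau(a)=\lim_{h\downarrow0}\frac{F_{\tau+h}(a)-\psi_\tau(a)}h$, $$D_\tau(a)=V_H^*(3)\ge\frac{8\log3-4\log2}{9}>0=V_K^*(a).$$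
   Context: $\overline{\mathbb D}$ is the closed unit disk in $\mathbb C$, $\log^+t=\max\{\log t,0\}$, $\log^+0=0$. For $\delta>0$, $\mathcal L_\delta$ is the class of $u\in\mathrm{PSH}(\mathbb C^N)$ with $u\le\delta\log^+\|z\|+C_u$ on $\mathbb C^N$, and $\mathcal L_\delta^+$ the subclass with also $u\ge\delta\log^+\|z\|-C_u$. $f^*(z)=\limsup_{\zeta\to z}f(\zeta)$. $V_{\delta,K,\psi}(z)=\sup\{u(z):u\in\mathcal L_\delta,\ u\le\psi\text{ on }K\}$, $V_K=V_{1,K,0}$; $V_H$ is taken in $\mathbb C$. For $j\ge1$ set $q_j=3-2^{-j}$, $r_j=e^{-16\cdot2^j}$, $I_j=[q_j-r_j,q_j+r_j]\subset\mathbb R$; $I=\{3\}\cup\bigcup_{j\ge1}I_j$, $H=\overline{\mathbb D}\cup I\subset\mathbb C$. In $\mathbb C^2$ with coordinates $(z,w)$: $A=\{|z|^2+|w|^2\le1\}$, $\Gamma=\{(e^{i\theta},t):-\pi\le\theta\le\pi,\ 3\le t\le4-\cos\theta\}$, $B=(\overline{\mathbb D}\times I)\cup\Gamma$, $K=A\cup B$. Weight: $b>0$ is a constant and $\Phi\in C^\infty(\mathbb C^2)\cap\mathcal L_1^+$ is a radial function such that $\Phi$ is plurisubharmonic with $0\le\Phi\le b$ on the closed unit ball; $\Phi(z)=\log\|z\|+b$ for $\|z\|\ge1$ and $\Phi(z)\ge b+\log\|z\|$ for $z\ne0$; and $dd^c\Phi$ has rank $1$ on $\{\|z\|>1\}$.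 (For this weight $F_\tau=\tau\Phi$ on $\mathbb C^2$.) *)

theory Defs
  imports "HOL-Analysis.Analysis"
begin

section \<open>Plurisubharmonic functions\<close>

definition usc :: "('a::topological_space \<Rightarrow> ereal) \<Rightarrow> bool" where
  "usc u \<longleftrightarrow> (\<forall>t. open {x. u x < t})"

text \<open>The integral of the positive part minus that of the negative part, over the circle and
  divided by \<open>2\<pi>\<close>; \<^const>\<open>e2ennreal\<close> truncates negative values to \<open>0\<close>. For an
  upper semicontinuous \<open>v < \<infinity>\<close> the first integral is finite, so the difference is meaningful
  and may be \<open>-\<infinity>\<close>.\<close>

definition circle_mean :: "(complex \<Rightarrow> ereal) \<Rightarrow> complex \<Rightarrow> real \<Rightarrow> ereal" where
  "circle_mean v c r = ereal (1 / (2 * pi)) *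
     (enn2ereal (\<integral>\<^sup>+\<theta>\<in>{0..2*pi}. e2ennreal (v (c + of_real r * cis \<theta>)) \<partial>lborel)
    - enn2ereal (\<integral>\<^sup>+\<theta>\<in>{0..2*pi}. e2ennreal (- v (c + of_real r * cis \<theta>)) \<partial>lborel))"

text \<open>Subharmonic on all of \<open>\<complex>\<close>, the constant \<open>-\<infinity>\<close> allowed (it can occur on single
  complex lines in the definition below).\<close>

definition subharmonic :: "(complex \<Rightarrow> ereal) \<Rightarrow> bool" where
  "subharmonic v \<longleftrightarrow> usc v \<and> (\<forall>z. v z < \<infinity>) \<and> (\<forall>c. \<forall>r>0. v c \<le> circle_mean v c r)"

definition psh :: "(complex^'n \<Rightarrow> ereal) \<Rightarrow> bool" where
  "psh u \<longleftrightarrow> usc u \<and> (\<exists>z. u z \<noteq> -\<infinity>) \<and> (\<forall>a b. subharmonic (\<lambda>\<zeta>. u (a + \<zeta> *s b)))"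

section \<open>Lelong classes and weighted extremal functions\<close>

definition log_plus :: "real \<Rightarrow> real" where
  "log_plus t = (if t = 0 then 0 else max (ln t) 0)"

definition Lelong :: "real \<Rightarrow> (complex^'n \<Rightarrow> ereal) set" where
  "Lelong \<delta> = {u. psh u \<and> (\<exists>C. \<forall>z. u z \<le> ereal (\<delta> * log_plus (norm z) + C))}"

definition Lelong_plus :: "real \<Rightarrow> (complex^'n \<Rightarrow> ereal) set" where
  "Lelong_plus \<delta> = {u \<in> Lelong \<delta>. \<exists>C. \<forall>z. u z \<ge> ereal (\<delta> * log_plus (norm z) - C)}"

text \<open>The neighbourhoods in the limes superior include the point itself, so that \<open>f \<le> usc_reg f\<close>.\<close>

definition usc_reg :: "('a::topological_space \<Rightarrow> ereal) \<Rightarrow> 'a \<Rightarrow> ereal" where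
  "usc_reg f z = Limsup (nhds z) f"

text \<open>Only the values of \<open>\<psi>\<close> on \<open>K\<close> matter.\<close>

definition extremal :: "real \<Rightarrow> (complex^'n) set \<Rightarrow> (complex^'n \<Rightarrow> real) \<Rightarrow> complex^'n \<Rightarrow> ereal" where
  "extremal \<delta> K \<psi> z = (SUP u \<in> {u \<in> Lelong \<delta>. \<forall>p\<in>K. u p \<le> ereal (\<psi> p)}. u z)"

section \<open>Smoothness and the rank of the Levi form\<close>

primrec Ck :: "nat \<Rightarrow> ('a::euclidean_space \<Rightarrow> real) \<Rightarrow> bool" where
  "Ck 0 f \<longleftrightarrow> continuous_on UNIV f"
| "Ck (Suc k) f \<longleftrightarrow> (\<forall>x. f differentiable (at x)) \<and>
     (\<forall>v\<in>Basis. Ck k (\<lambda>x. frechet_derivative f (at x) v))"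

definition C_infinity :: "('a::euclidean_space \<Rightarrow> real) \<Rightarrow> bool" where
  "C_infinity f \<longleftrightarrow> (\<forall>k. Ck k f)"

definition wirtinger :: "'n \<Rightarrow> (complex^'n \<Rightarrow> complex) \<Rightarrow> complex^'n \<Rightarrow> complex" where
  "wirtinger j f p = (frechet_derivative f (at p) (axis j 1)
                      - \<i> * frechet_derivative f (at p) (axis j \<i>)) / 2"

definition wirtinger_bar :: "'n \<Rightarrow> (complex^'n \<Rightarrow> complex) \<Rightarrow> complex^'n \<Rightarrow> complex" where
  "wirtinger_bar j f p = (frechet_derivative f (at p) (axis j 1)
                          + \<i> * frechet_derivative f (at p) (axis j \<i>)) / 2"

text \<open>The coefficient matrix of \<open>dd\<^sup>c f\<close>, up to the normalisation of \<open>d\<^sup>c\<close>. The rank of the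
  (1,1)-form \<open>dd\<^sup>c f\<close> is the complex rank of this matrix.\<close>

definition complex_hessian :: "(complex^'n \<Rightarrow> real) \<Rightarrow> complex^'n \<Rightarrow> complex^'n^'n" where
  "complex_hessian f p =
     (\<chi> j k. wirtinger j (wirtinger_bar k (\<lambda>z. complex_of_real (f z))) p)"

section \<open>The compact sets\<close>

definition q_seq :: "nat \<Rightarrow> real" where
  "q_seq j = 3 - 1 / 2 ^ j"

definition r_seq :: "nat \<Rightarrow> real" where
  "r_seq j = exp (- 16 * 2 ^ j)"

definition set_I :: "complex set" where
  "set_I = {3} \<union> (\<Union>j\<in>{1..}. complex_of_real ` {q_seq j - r_seq j .. q_seq j + r_seq j})"

definition set_H :: "complex set" where
  "set_H = cball 0 1 \<union> set_I"

text \<open>\<open>\<complex>\<close> as \<open>\<complex>\<^sup>1\<close>, so that the definitions above apply to it.\<close>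

definition V_H_star :: "complex \<Rightarrow> ereal" where
  "V_H_star \<zeta> = usc_reg (extremal 1 {z :: complex^1. z $ 1 \<in> set_H} (\<lambda>_. 0)) (vec \<zeta>)"

definition set_A :: "(complex^2) set" where
  "set_A = {p. (cmod (p $ 1))\<^sup>2 + (cmod (p $ 2))\<^sup>2 \<le> 1}"

definition set_Gamma :: "(complex^2) set" where
  "set_Gamma = {vector [cis \<theta>, complex_of_real t] | \<theta> t.
     - pi \<le> \<theta> \<and> \<theta> \<le> pi \<and> 3 \<le> t \<and> t \<le> 4 - cos \<theta>}"

definition set_B :: "(complex^2) set" where
  "set_B = {p. p $ 1 \<in> cball 0 1 \<and> p $ 2 \<in> set_I} \<union> set_Gamma"

definition set_K :: "(complex^2) set" where
  "set_K = set_A \<union> set_B"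

definition V_K_star :: "complex^2 \<Rightarrow> ereal" where
  "V_K_star = usc_reg (extremal 1 set_K (\<lambda>_. 0))"

definition pt_a :: "complex^2" where
  "pt_a = vector [0, 3]"

definition kappa :: "real \<Rightarrow> real" where
  "kappa \<tau> = \<tau> * ln (26 / 25) / (2 * ln 5)"

definition F_ext :: "(complex^2 \<Rightarrow> real) \<Rightarrow> real \<Rightarrow> real \<Rightarrow> complex^2 \<Rightarrow> ereal" where
  "F_ext \<Phi> \<tau> \<delta> = usc_reg (extremal \<delta> set_K (\<lambda>p. \<tau> * \<Phi> p))"

end

theory Submission
  imports Defs "HOL-Complex_Analysis.Cauchy_Integral_Formula"
begin

text \<open>
  The upper bound and the lower bound come from comparing competitors of the weighted problem on
  \<open>\<complex>\<^sup>2\<close> with competitors of \<open>V\<^sub>H\<close> on \<open>\<complex>\<close>, in both directions.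

  A competitor \<open>u\<close> of degree \<open>\<tau> + h\<close>, restricted to a line through the origin near the \<open>w\<close>-axis, is at
  most \<open>\<tau> \<Phi>\<close> on the unit disc and on a copy of \<open>I\<close>. Outside the disc \<open>\<Phi>\<close> is harmonic on the line.
  Subtracting \<open>\<tau> \<Phi>\<close> there and gluing with \<open>0\<close> inside therefore gives a subharmonic function of
  degree \<open>h\<close> that is nonpositive on \<open>H\<close> up to a small error, so it is at most \<open>h V\<^sub>H\<close>
  (\<open>competitor_bound_near_axis\<close>). Conversely, \<open>\<tau> (b + ln |w|) + h g(w)\<close> is a competitor of the
  weighted problem whenever \<open>g\<close> is one of \<open>V\<^sub>H\<close> and \<open>h \<le> kappa \<tau>\<close>
  (\<open>V_H_bound_from_extremal\<close>); the only obstruction is \<open>\<Gamma>\<close>, where the weight leaves a margin that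
  \<open>kappa \<tau>\<close> measures. For larger \<open>h\<close> monotonicity in the degree suffices.

  The number \<open>V\<^sub>H\<^sup>*(3)\<close> is positive because \<open>H\<close> is thin at \<open>3\<close>: the intervals \<open>I\<^sub>j\<close> are so short that
  logarithmic poles at the \<open>q\<^sub>j\<close>, with rapidly decreasing weights, push \<open>ln |z|\<close> below \<open>0\<close> on all of
  them while costing only a bounded amount near \<open>3\<close> (\<open>V_H_ge_right_of_3\<close>). In contrast,
  \<open>V\<^sub>K\<^sup>*(a) = 0\<close> because of \<open>\<Gamma>\<close>: for real \<open>t\<close> slightly above \<open>3\<close> the disc at height \<open>t\<close> has almost
  all of its boundary in \<open>\<Gamma>\<close>, so competitors are small on it; and then, for fixed \<open>z\<close>, they are small
  near the end point \<open>3\<close> of a real segment, because segments are regular at their end points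
  (\<open>K_competitor_small_near_a\<close>).

  All estimates are instances of one maximum principle on complex lines, \<open>maximum_principle\<close>. All
  functions that are constructed have the sub-mean value property for small circles by inspection;
  \<open>subharmonic_local\<close> extends it to all circles.
\<close>

section \<open>Averages over circles\<close>

definition circ_avg :: "(real \<Rightarrow> real) \<Rightarrow> real" where
  "circ_avg \<phi> = integral {0..2*pi} \<phi> / (2*pi)"

lemma circ_avg_eq_parts:
  assumes "continuous_on {0..2*pi} \<phi>"
  defines "P \<equiv> (\<integral>\<^sup>+\<theta>\<in>{0..2*pi}. e2ennreal (ereal (\<phi> \<theta>)) \<partial>lborel)"
    and "N \<equiv> (\<integral>\<^sup>+\<theta>\<in>{0..2*pi}. e2ennreal (- ereal (\<phi> \<theta>)) \<partial>lborel)"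
  shows "P < \<infinity>" "N < \<infinity>" "ereal (1 / (2 * pi)) * (enn2ereal P - enn2ereal N) = ereal (circ_avg \<phi>)"
proof -
  let ?f = "\<lambda>\<theta>. indicator {0..2*pi} \<theta> *\<^sub>R \<phi> \<theta> :: real"
  have int: "integrable lborel ?f"
    using assms(1) by (intro borel_integrable_compact) auto
  have P: "P = (\<integral>\<^sup>+\<theta>. ennreal (?f \<theta>) \<partial>lborel)"
    unfolding P_def by (intro nn_integral_cong) (auto split: split_indicator)
  have N: "N = (\<integral>\<^sup>+\<theta>. ennreal (- ?f \<theta>) \<partial>lborel)"
    unfolding N_def by (intro nn_integral_cong) (auto split: split_indicator)
  show fin: "P < \<infinity>" "N < \<infinity>"
    using int unfolding real_integrable_def P N by (auto simp: top.not_eq_extremum)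
  have "integral\<^sup>L lborel ?f = integral {0..2*pi} \<phi>"
    using set_borel_integral_eq_integral(2)[of "{0..2*pi}" \<phi>] int
    by (simp add: set_integrable_def set_lebesgue_integral_def)
  then have "enn2real P - enn2real N = integral {0..2*pi} \<phi>"
    using real_lebesgue_integral_def[OF int] unfolding P N by simp
  moreover have "enn2ereal P = ereal (enn2real P)" "enn2ereal N = ereal (enn2real N)"
    using fin by (metis ennreal_enn2real enn2real_nonneg enn2ereal_ennreal infinity_ennreal_def)+
  ultimately show "ereal (1 / (2 * pi)) * (enn2ereal P - enn2ereal N) = ereal (circ_avg \<phi>)"
    by (simp add: circ_avg_def)
qed

text \<open>Monotonicity of the two integrals in the definition of a circle mean. Comparison with a
  continuous majorant is all that the maximum principle below ever does with circle means.\<close>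

lemma circle_mean_le_circ_avg:
  assumes \<phi>: "continuous_on {0..2*pi} \<phi>"
    and le: "\<And>\<theta>. \<theta> \<in> {0..2*pi} \<Longrightarrow> v (c + of_real r * cis \<theta>) \<le> ereal (\<phi> \<theta>)"
  shows "circle_mean v c r \<le> ereal (circ_avg \<phi>)"
proof -
  note parts = circ_avg_eq_parts[OF \<phi>]
  show ?thesis
    unfolding circle_mean_def parts(3)[symmetric]
  proof (intro ereal_mult_left_mono ereal_minus_mono)
    show "enn2ereal (\<integral>\<^sup>+\<theta>\<in>{0..2*pi}. e2ennreal (v (c + of_real r * cis \<theta>)) \<partial>lborel)
        \<le> enn2ereal (\<integral>\<^sup>+\<theta>\<in>{0..2*pi}. e2ennreal (ereal (\<phi> \<theta>)) \<partial>lborel)"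
      unfolding less_eq_ennreal.rep_eq[symmetric]
      by (intro nn_integral_mono) (auto split: split_indicator intro!: e2ennreal_mono le simp del: e2ennreal_ereal)
    show "enn2ereal (\<integral>\<^sup>+\<theta>\<in>{0..2*pi}. e2ennreal (- ereal (\<phi> \<theta>)) \<partial>lborel)
        \<le> enn2ereal (\<integral>\<^sup>+\<theta>\<in>{0..2*pi}. e2ennreal (- v (c + of_real r * cis \<theta>)) \<partial>lborel)"
      unfolding less_eq_ennreal.rep_eq[symmetric]
      by (intro nn_integral_mono)
         (auto split: split_indicator intro!: e2ennreal_mono le simp: ereal_uminus_le_reorder simp del: uminus_ereal.simps)
  qed auto
qed

lemma tendsto_e2ennreal: "(f \<longlongrightarrow> x) F \<Longrightarrow> ((\<lambda>n. e2ennreal (f n)) \<longlongrightarrow> e2ennreal x) F"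
  by (rule continuous_on_tendsto_compose[OF continuous_on_e2ennreal[of UNIV]]) auto

lemma tendsto_enn2ereal: "(f \<longlongrightarrow> x) F \<Longrightarrow> ((\<lambda>n. enn2ereal (f n)) \<longlongrightarrow> enn2ereal x) F"
  by (rule continuous_on_tendsto_compose[OF continuous_on_enn2ereal]) auto

text \<open>The two halves of \<open>circle_mean\<close> pass to the limit separately: the positive parts decrease from
  a finite integral, the negative parts increase. The first limit is finite, so the difference
  converges even when \<open>v\<close> takes the value \<open>-\<infinity>\<close>.\<close>

lemma le_circle_mean_decreasing_limit:
  assumes cont: "\<And>n. continuous_on {0..2*pi} (\<phi> n)"
    and dec: "\<And>n \<theta>. \<theta> \<in> {0..2*pi} \<Longrightarrow> \<phi> (Suc n) \<theta> \<le> \<phi> n \<theta>"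
    and lim: "\<And>\<theta>. \<theta> \<in> {0..2*pi} \<Longrightarrow> (INF n. ereal (\<phi> n \<theta>)) = v (c + of_real r * cis \<theta>)"
    and le: "\<And>n. x \<le> ereal (circ_avg (\<phi> n))"
  shows "x \<le> circle_mean v c r"
proof -
  let ?I = "{0..2*pi}"
  define p where "p n \<theta> = e2ennreal (ereal (\<phi> n \<theta>)) * indicator ?I \<theta>" for n \<theta>
  define m where "m n \<theta> = e2ennreal (- ereal (\<phi> n \<theta>)) * indicator ?I \<theta>" for n \<theta>
  define P where "P n = (\<integral>\<^sup>+\<theta>. p n \<theta> \<partial>lborel)" for n
  define N where "N n = (\<integral>\<^sup>+\<theta>. m n \<theta> \<partial>lborel)" for n
  have fin: "P n < \<infinity>" "N n < \<infinity>"
    and avg: "ereal (1 / (2 * pi)) * (enn2ereal (P n) - enn2ereal (N n)) = ereal (circ_avg (\<phi> n))" for n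
    using circ_avg_eq_parts[OF cont[of n]] by (simp_all add: P_def N_def p_def m_def del: e2ennreal_ereal uminus_ereal.simps)
  have meas: "p n \<in> borel_measurable lborel" "m n \<in> borel_measurable lborel" for n
  proof -
    have "(\<lambda>\<theta>. indicator ?I \<theta> *\<^sub>R \<phi> n \<theta>) \<in> borel_measurable borel"
      using cont[of n] by (intro borel_measurable_continuous_on_indicator) auto
    then have *: "(\<lambda>\<theta>. ennreal (indicator ?I \<theta> *\<^sub>R \<phi> n \<theta>)) \<in> borel_measurable lborel"
      "(\<lambda>\<theta>. ennreal (- (indicator ?I \<theta> *\<^sub>R \<phi> n \<theta>))) \<in> borel_measurable lborel" by measurable
    have "p n = (\<lambda>\<theta>. ennreal (indicator ?I \<theta> *\<^sub>R \<phi> n \<theta>))" "m n = (\<lambda>\<theta>. ennreal (- (indicator ?I \<theta> *\<^sub>R \<phi> n \<theta>)))"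
      by (auto simp: p_def m_def fun_eq_iff split: split_indicator)
    with * show "p n \<in> borel_measurable lborel" "m n \<in> borel_measurable lborel" by simp_all
  qed
  have dp: "decseq p"
    by (intro decseq_SucI le_funI) (auto simp: p_def intro!: ennreal_leI dec split: split_indicator)
  have im: "incseq m"
    by (intro incseq_SucI le_funI) (auto simp: m_def intro!: ennreal_leI dec split: split_indicator)
  have lim': "(\<lambda>n. ereal (\<phi> n \<theta>)) \<longlonglongrightarrow> v (c + of_real r * cis \<theta>)" if "\<theta> \<in> ?I" for \<theta>
    using LIMSEQ_INF[of "\<lambda>n. ereal (\<phi> n \<theta>)"] dec[OF that] lim[OF that] by (simp add: decseq_SucI)
  have p_lim: "(INF n. p n \<theta>) = e2ennreal (v (c + of_real r * cis \<theta>)) * indicator ?I \<theta>" for \<theta>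
  proof (rule LIMSEQ_unique)
    show "(\<lambda>n. p n \<theta>) \<longlonglongrightarrow> (INF n. p n \<theta>)"
      by (rule LIMSEQ_INF) (use decseqD[OF dp] in \<open>auto simp: le_fun_def decseq_def\<close>)
    show "(\<lambda>n. p n \<theta>) \<longlonglongrightarrow> e2ennreal (v (c + of_real r * cis \<theta>)) * indicator ?I \<theta>"
    proof (cases "\<theta> \<in> ?I")
      case True
      then show ?thesis
        using tendsto_e2ennreal[OF lim'[OF True]] by (simp add: p_def)
    qed (simp add: p_def)
  qed
  have m_lim: "(SUP n. m n \<theta>) = e2ennreal (- v (c + of_real r * cis \<theta>)) * indicator ?I \<theta>" for \<theta>
  proof (rule LIMSEQ_unique)
    show "(\<lambda>n. m n \<theta>) \<longlonglongrightarrow> (SUP n. m n \<theta>)"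
      by (rule LIMSEQ_SUP) (use incseqD[OF im] in \<open>auto simp: le_fun_def incseq_def\<close>)
    show "(\<lambda>n. m n \<theta>) \<longlonglongrightarrow> e2ennreal (- v (c + of_real r * cis \<theta>)) * indicator ?I \<theta>"
    proof (cases "\<theta> \<in> ?I")
      case True
      have "(\<lambda>n. - ereal (\<phi> n \<theta>)) \<longlonglongrightarrow> - v (c + of_real r * cis \<theta>)"
        by (intro tendsto_uminus_ereal lim' True)
      then show ?thesis
        using tendsto_e2ennreal True by (fastforce simp: m_def)
    qed (simp add: m_def)
  qed
  have Plim: "(INF n. P n) = (\<integral>\<^sup>+\<theta>\<in>?I. e2ennreal (v (c + of_real r * cis \<theta>)) \<partial>lborel)" (is "_ = ?P")
    using nn_integral_monotone_convergence_INF_decseq[OF dp meas(1), of 0] fin(1)[of 0]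
    by (simp add: P_def p_lim)
  have Nlim: "(SUP n. N n) = (\<integral>\<^sup>+\<theta>\<in>?I. e2ennreal (- v (c + of_real r * cis \<theta>)) \<partial>lborel)" (is "_ = ?N")
    using nn_integral_monotone_convergence_SUP[OF im meas(2)]
    by (simp add: N_def m_lim)
  have "decseq P" "incseq N"
    unfolding P_def N_def using decseqD[OF dp] incseqD[OF im]
    by (auto simp: le_fun_def intro!: decseq_SucI incseq_SucI nn_integral_mono)
  have "P \<longlonglongrightarrow> ?P" "N \<longlonglongrightarrow> ?N"
    using LIMSEQ_INF[OF \<open>decseq P\<close>] LIMSEQ_SUP[OF \<open>incseq N\<close>] Plim Nlim by simp_all
  then have "(\<lambda>n. enn2ereal (P n)) \<longlonglongrightarrow> enn2ereal ?P" "(\<lambda>n. enn2ereal (N n)) \<longlonglongrightarrow> enn2ereal ?N"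
    by (auto intro: tendsto_enn2ereal)
  moreover have "?P < \<infinity>"
    using fin(1)[of 0] Plim by (metis INF_lower UNIV_I le_less_trans)
  then have "\<bar>enn2ereal ?P\<bar> \<noteq> \<infinity>"
    by (metis abs_ereal_ge0 enn2ereal_eq_top_iff enn2ereal_nonneg infinity_ennreal_def less_irrefl)
  ultimately have "(\<lambda>n. enn2ereal (P n) - enn2ereal (N n)) \<longlonglongrightarrow> enn2ereal ?P - enn2ereal ?N"
    by (intro tendsto_diff_ereal_general) auto
  then have "(\<lambda>n. ereal (1 / (2 * pi)) * (enn2ereal (P n) - enn2ereal (N n))) \<longlonglongrightarrow> ereal (1 / (2 * pi)) * (enn2ereal ?P - enn2ereal ?N)"
    by (intro tendsto_cmult_ereal) auto
  then have "(\<lambda>n. ereal (circ_avg (\<phi> n))) \<longlonglongrightarrow> circle_mean v c r"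
    by (simp add: avg circle_mean_def)
  then show ?thesis
    by (rule LIMSEQ_le_const) (use le in auto)
qed

text \<open>Cauchy's formula at the centre of the circle, with the parameter interval stretched from
  \<open>[0, 1]\<close> to \<open>[0, 2\<pi>]\<close>.\<close>

lemma mean_value_Re_holomorphic:
  assumes F: "F holomorphic_on ball c R" and r: "0 < r" "r < R"
  shows "((\<lambda>\<theta>. Re (F (c + of_real r * cis \<theta>))) has_integral (2 * pi * Re (F c))) {0..2*pi}"
proof -
  have "F holomorphic_on cball c r"
    using F r by (auto intro: holomorphic_on_subset)
  then have "((\<lambda>u. F u / (u - c)) has_contour_integral (2 * of_real pi * \<i> * F c)) (circlepath c r)"
    using r by (intro Cauchy_integral_circlepath_simple) auto
  then have "((\<lambda>x. F (circlepath c r x) / (circlepath c r x - c) * (2 * pi * \<i> * r * exp (2 * of_real pi * \<i> * x)))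
      has_integral (2 * of_real pi * \<i> * F c)) {0..1}"
    unfolding has_contour_integral
    by (rule has_integral_eq[rotated]) (auto simp: vector_derivative_circlepath01 vector_derivative_circlepath)
  then have 1: "((\<lambda>x. 2 * of_real pi * \<i> * F (c + of_real r * cis (2 * pi * x)))
      has_integral (2 * of_real pi * \<i> * F c)) {0..1}"
    by (rule has_integral_eq[rotated])
      (use r in \<open>auto simp: circlepath cis_conv_exp field_simps\<close>)
  have "((\<lambda>x. F (c + of_real r * cis (2 * pi * x))) has_integral F c) {0..1}"
    using has_integral_mult_right[OF 1, of "1 / (2 * of_real pi * \<i>)"] by simp
  then have "((\<lambda>x. F (c + of_real r * cis (2 * pi * x))) has_integral F c) (cbox 0 1)" by simp
  from has_integral_affinity[OF this, of "1 / (2*pi)" 0]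
  have "((\<lambda>x. F (c + of_real r * cis x)) has_integral (2 * pi) *\<^sub>R F c) ((\<lambda>x. 2 * pi * x) ` {0..1})"
    by simp
  moreover have "((\<lambda>x. 2 * pi * x) ` {0..1}) = {0..2*pi}"
    by (simp add: image_mult_atLeastAtMost)
  ultimately have "((\<lambda>x. F (c + of_real r * cis x)) has_integral (2 * pi) *\<^sub>R F c) {0..2*pi}" by simp
  from has_integral_Re[OF this] show ?thesis by simp
qed

section \<open>The maximum principle\<close>

text \<open>The sub-mean value property tested against continuous majorants only. Unlike the
  inequality with \<open>circle_mean\<close>, this form is visibly stable under adding harmonic functions and
  under enlarging a function away from the centre.\<close>

definition circ_submean :: "(complex \<Rightarrow> ereal) \<Rightarrow> complex \<Rightarrow> real \<Rightarrow> bool" where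
  "circ_submean v c r \<longleftrightarrow> (\<forall>\<phi>. continuous_on {0..2*pi} \<phi> \<longrightarrow>
     (\<forall>\<theta>\<in>{0..2*pi}. v (c + of_real r * cis \<theta>) \<le> ereal (\<phi> \<theta>)) \<longrightarrow> v c \<le> ereal (circ_avg \<phi>))"

definition loc_submean :: "(complex \<Rightarrow> ereal) \<Rightarrow> complex \<Rightarrow> bool" where
  "loc_submean v c \<longleftrightarrow> (\<exists>R>0. \<forall>r. 0 < r \<and> r < R \<longrightarrow> circ_submean v c r)"

text \<open>Harmonicity in the form in which it is used: being the real part of a holomorphic function
  gives the mean value property by Cauchy's formula.\<close>

definition loc_harmonic :: "(complex \<Rightarrow> real) \<Rightarrow> complex \<Rightarrow> bool" where
  "loc_harmonic h c \<longleftrightarrow> (\<exists>R>0. \<exists>F. F holomorphic_on ball c R \<and> (\<forall>z\<in>ball c R. h z = Re (F z)))"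

lemma uscD: "usc v \<Longrightarrow> open {x. v x < t}"
  by (simp add: usc_def)

text \<open>Upper semicontinuity survives adding a function that is continuous on a subset only; the
  comparison functions below are not continuous on the whole plane.\<close>

lemma usc_plus_continuous_nbhd:
  fixes v :: "'a::topological_space \<Rightarrow> ereal"
  assumes v: "usc v" and k: "continuous_on S k" and x: "x \<in> S" and lt: "v x + ereal (k x) < t"
  obtains N where "open N" "x \<in> N" "\<And>z. z \<in> N \<Longrightarrow> z \<in> S \<Longrightarrow> v z + ereal (k z) < t"
proof -
  have "v x < t - ereal (k x)"
    using lt by (simp add: ereal_less_minus)
  then obtain s where s: "v x < ereal s" "ereal s < t - ereal (k x)"
    using ereal_dense2 by blast
  then have "ereal (s + k x) < t"
    by (simp add: ereal_less_minus)
  then obtain t' where t': "ereal (s + k x) < ereal t'" "ereal t' < t"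
    using ereal_dense2 by blast
  have "open {..<t' - s}" by simp
  then obtain N where N: "open N" "N \<inter> S = k -` {..<t' - s} \<inter> S"
    using k unfolding continuous_on_open_invariant by blast
  show ?thesis
  proof
    show "open ({z. v z < ereal s} \<inter> N)" using uscD[OF v] N by auto
    have "x \<in> k -` {..<t' - s} \<inter> S" using t' x by simp
    then show "x \<in> {z. v z < ereal s} \<inter> N" using s N(2) by blast
    fix z assume z: "z \<in> {z. v z < ereal s} \<inter> N" "z \<in> S"
    then have "z \<in> k -` {..<t' - s} \<inter> S" using N(2) by blast
    then have "k z < t' - s" by simp
    then have "ereal s + ereal (k z) \<le> ereal t'" by simp
    moreover have "v z + ereal (k z) \<le> ereal s + ereal (k z)"
      using z by (intro add_mono) auto
    ultimately show "v z + ereal (k z) < t" using t'(2) by (meson le_less_trans)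
  qed
qed

lemma usc_plus_continuous_attains_max:
  fixes v :: "'a::topological_space \<Rightarrow> ereal"
  assumes v: "usc v" and k: "continuous_on S k" and S: "compact S" "S \<noteq> {}"
  obtains x where "x \<in> S" "\<And>y. y \<in> S \<Longrightarrow> v y + ereal (k y) \<le> v x + ereal (k x)"
proof -
  define f where "f x = v x + ereal (k x)" for x
  have "\<exists>x\<in>S. \<forall>y\<in>S. f y \<le> f x"
  proof (rule ccontr)
    assume "\<not> ?thesis"
    then have "\<forall>x\<in>S. \<exists>y. y \<in> S \<and> f x < f y" by (auto simp: not_le)
    then obtain g where g: "\<And>x. x \<in> S \<Longrightarrow> g x \<in> S \<and> f x < f (g x)"
      by metis
    have "\<forall>x\<in>S. \<exists>N. open N \<and> x \<in> N \<and> (\<forall>z\<in>N \<inter> S. f z < f (g x))"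
    proof
      fix x assume x: "x \<in> S"
      show "\<exists>N. open N \<and> x \<in> N \<and> (\<forall>z\<in>N \<inter> S. f z < f (g x))"
        using usc_plus_continuous_nbhd[OF v k x, of "f (g x)"] g[OF x] unfolding f_def by (metis IntD1 IntD2)
    qed
    then obtain N where N: "\<And>x. x \<in> S \<Longrightarrow> open (N x) \<and> x \<in> N x \<and> (\<forall>z\<in>N x \<inter> S. f z < f (g x))"
      by metis
    obtain T where T: "T \<subseteq> S" "finite T" "S \<subseteq> (\<Union>x\<in>T. N x)"
      using compactE_image[OF S(1), of S N] N by blast
    have "T \<noteq> {}" using T S by auto
    then have "finite ((\<lambda>x. f (g x)) ` T)" "((\<lambda>x. f (g x)) ` T) \<noteq> {}" using T by auto
    then obtain x where x: "x \<in> T" "\<And>y. y \<in> T \<Longrightarrow> f (g y) \<le> f (g x)"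
      using Max_in[of "(\<lambda>x. f (g x)) ` T"] Max_ge[of "(\<lambda>x. f (g x)) ` T"] by fastforce
    then have "g x \<in> S" using g T by blast
    then obtain y where "y \<in> T" "g x \<in> N y" using T by blast
    then have "f (g x) < f (g y)" using N T \<open>g x \<in> S\<close> by blast
    then show False using x(2)[OF \<open>y \<in> T\<close>] by simp
  qed
  then show ?thesis using that by (auto simp: f_def)
qed

lemma circ_avg_Re_holomorphic:
  assumes "F holomorphic_on ball c R" "0 < r" "r < R"
  shows "continuous_on {0..2*pi} (\<lambda>\<theta>. Re (F (c + of_real r * cis \<theta>)))"
    and "circ_avg (\<lambda>\<theta>. Re (F (c + of_real r * cis \<theta>))) = Re (F c)"
proof -
  have "continuous_on (ball c R) F"
    using assms holomorphic_on_imp_continuous_on by blast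
  then have "continuous_on {0..2*pi} (\<lambda>\<theta>. F (c + of_real r * cis \<theta>))"
    by (rule continuous_on_compose2) (use assms in \<open>auto intro!: continuous_intros simp: dist_norm norm_mult\<close>)
  then show "continuous_on {0..2*pi} (\<lambda>\<theta>. Re (F (c + of_real r * cis \<theta>)))"
    by (intro continuous_intros)
  show "circ_avg (\<lambda>\<theta>. Re (F (c + of_real r * cis \<theta>))) = Re (F c)"
    using integral_unique[OF mean_value_Re_holomorphic[OF assms]] by (simp add: circ_avg_def)
qed

text \<open>If \<open>v - h\<close> were positive somewhere in \<open>U\<close>, then for small \<open>\<epsilon>\<close> the maximum of
  \<open>v - h + \<epsilon> |z|\<^sup>2\<close> over the closure would still lie at an interior point \<open>x\<close>. The added term makes
  the mean over a small circle strictly larger than the value at its centre, by \<open>\<epsilon> r\<^sup>2\<close>, which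
  contradicts maximality at \<open>x\<close>.\<close>

proposition maximum_principle:
  assumes v: "usc v" "\<And>z. v z < \<infinity>"
    and U: "open U" "bounded U"
    and sub: "\<And>c. c \<in> U \<Longrightarrow> loc_submean v c"
    and h: "continuous_on (closure U) h" "\<And>c. c \<in> U \<Longrightarrow> loc_harmonic h c"
    and frontier: "\<And>z. z \<in> closure U \<Longrightarrow> z \<notin> U \<Longrightarrow> v z \<le> ereal (h z)"
    and p: "p \<in> U"
  shows "v p \<le> ereal (h p)"
proof (rule ccontr)
  assume "\<not> v p \<le> ereal (h p)"
  with v(2)[of p] obtain a where a: "v p = ereal a" "h p < a"
    by (cases "v p") auto
  have "bounded (closure U)" using U by (simp add: bounded_closure)
  then obtain B0 where B0: "\<And>z. z \<in> closure U \<Longrightarrow> norm z \<le> B0" by (auto simp: bounded_iff)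
  define B where "B = B0\<^sup>2"
  have B: "(norm z)\<^sup>2 \<le> B" if "z \<in> closure U" for z
    using B0[OF that] by (simp add: B_def power_mono)
  define \<epsilon> where "\<epsilon> = (a - h p) / (B + 1)"
  have "B \<ge> 0" by (simp add: B_def)
  then have \<epsilon>: "\<epsilon> > 0" "\<epsilon> * B < a - h p"
    using a by (auto simp: \<epsilon>_def field_simps)
  define k where "k z = \<epsilon> * (norm z)\<^sup>2 - h z" for z
  have k: "continuous_on (closure U) k" unfolding k_def by (intro continuous_intros h)
  have pc: "p \<in> closure U" using p closure_subset by blast
  have "compact (closure U)" "closure U \<noteq> {}" using U pc by auto
  from usc_plus_continuous_attains_max[OF v(1) k this]
  obtain x where x: "x \<in> closure U" "\<And>y. y \<in> closure U \<Longrightarrow> v y + ereal (k y) \<le> v x + ereal (k x)"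
    by metis
  have px: "ereal (a + k p) \<le> v x + ereal (k x)" using x(2)[OF pc] a by simp
  then obtain b where b: "v x = ereal b" using v(2)[of x] by (cases "v x") auto
  have xU: "x \<in> U"
  proof (rule ccontr)
    assume "x \<notin> U"
    then have "b \<le> h x" using frontier[OF x(1)] b by simp
    then have "b + k x \<le> \<epsilon> * (norm x)\<^sup>2" by (simp add: k_def)
    also have "\<dots> \<le> \<epsilon> * B" using B[OF x(1)] \<epsilon> by simp
    also have "\<dots> < a - h p" by (rule \<epsilon>)
    also have "\<dots> \<le> a + k p" using \<epsilon> by (simp add: k_def)
    finally show False using px b by simp
  qed
  obtain R1 where R1: "R1 > 0" "ball x R1 \<subseteq> U" using U xU openE by blast
  obtain R2 where R2: "R2 > 0" "\<And>r. 0 < r \<Longrightarrow> r < R2 \<Longrightarrow> circ_submean v x r"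
    using sub[OF xU] by (auto simp: loc_submean_def)
  obtain R3 F where R3: "R3 > 0" "F holomorphic_on ball x R3" "\<And>z. z \<in> ball x R3 \<Longrightarrow> h z = Re (F z)"
    using h(2)[OF xU] by (auto simp: loc_harmonic_def)
  define r where "r = min R1 (min R2 R3) / 2"
  have r: "0 < r" "r < R1" "r < R2" "r < R3" using R1 R2 R3 by (auto simp: r_def)
  define G where "G z = of_real (b + k x) + F z - of_real (\<epsilon> * (r\<^sup>2 - (norm x)\<^sup>2)) - of_real (2 * \<epsilon>) * cnj x * z" for z
  have G: "G holomorphic_on ball x R3" unfolding G_def by (intro holomorphic_intros R3)
  have "v x \<le> ereal (circ_avg (\<lambda>\<theta>. Re (G (x + of_real r * cis \<theta>))))"
  proof -
    have "v (x + of_real r * cis \<theta>) \<le> ereal (Re (G (x + of_real r * cis \<theta>)))" for \<theta>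
    proof -
      let ?z = "x + of_real r * cis \<theta>"
      have z: "?z \<in> ball x R1" "?z \<in> ball x R3" using r by (auto simp: dist_norm norm_mult)
      then have "v ?z + ereal (k ?z) \<le> ereal (b + k x)"
        using x(2)[of ?z] R1 closure_subset b by fastforce
      then have "v ?z \<le> ereal (b + k x - k ?z)"
        by (cases "v ?z") auto
      also
      \<comment> \<open>on the circle \<open>|z|\<^sup>2\<close> is the real part of a polynomial, so \<open>G\<close> absorbs it\<close>
      have "(norm ?z)\<^sup>2 = r\<^sup>2 - (norm x)\<^sup>2 + 2 * Re (cnj x * ?z)"
        unfolding cmod_power2 by (simp add: power2_eq_square algebra_simps)
          (metis (no_types, opaque_lifting) cos_squared_eq add_diff_cancel_left' distrib_left mult.commute mult.left_commute mult_1 power2_eq_square sin_cos_squared_add2)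
      then have "k ?z = \<epsilon> * (r\<^sup>2 - (norm x)\<^sup>2 + 2 * Re (cnj x * ?z)) - Re (F ?z)"
        unfolding k_def[of ?z] R3(3)[OF z(2)] by (rule arg_cong)
      then have "b + k x - k ?z = Re (G ?z)"
        unfolding G_def by (simp add: algebra_simps)
      finally show ?thesis .
    qed
    then show ?thesis
      using R2(2)[of r] r circ_avg_Re_holomorphic(1)[OF G, of r] by (auto simp: circ_submean_def)
  qed
  also have "circ_avg (\<lambda>\<theta>. Re (G (x + of_real r * cis \<theta>))) = Re (G x)"
    using circ_avg_Re_holomorphic(2)[OF G] r by simp
  also have "Re (G x) = b + k x + h x - \<epsilon> * (r\<^sup>2 + (norm x)\<^sup>2)"
  proof -
    have "(norm x)\<^sup>2 = Re x * Re x + Im x * Im x"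
      by (metis cmod_power2 power2_eq_square)
    then show ?thesis unfolding G_def using R3(3)[of x] R3(1) by (simp add: algebra_simps)
  qed
  also have "\<dots> < b" using \<epsilon> r by (simp add: k_def algebra_simps)
  finally show False using b by simp
qed

section \<open>From the local to the global sub-mean value property\<close>

text \<open>The approximants are the sup-convolutions \<open>sup (v(y) - n d(x,y))\<close>, which are \<open>n\<close>-Lipschitz. A
  point \<open>y\<close> far from \<open>x\<close> is penalised below any given level as \<open>n\<close> grows, and near \<open>x\<close> upper
  semicontinuity bounds \<open>v(y)\<close>. Truncating \<open>v\<close> at \<open>-n\<close> keeps the suprema real.\<close>

lemma usc_decreasing_continuous_approximation:
  fixes v :: "'a::metric_space \<Rightarrow> ereal"
  assumes v: "usc v" "\<And>z. v z < \<infinity>" and S: "compact S" "S \<noteq> {}"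
  obtains \<phi> :: "nat \<Rightarrow> 'a \<Rightarrow> real" where
    "\<And>n. continuous_on UNIV (\<phi> n)" "\<And>n x. \<phi> (Suc n) x \<le> \<phi> n x"
    "\<And>n x. x \<in> S \<Longrightarrow> v x \<le> ereal (\<phi> n x)" "\<And>x. x \<in> S \<Longrightarrow> (INF n. ereal (\<phi> n x)) = v x"
proof -
  obtain x0 where x0: "x0 \<in> S" "\<And>y. y \<in> S \<Longrightarrow> v y + ereal 0 \<le> v x0 + ereal 0"
    using usc_plus_continuous_attains_max[OF v(1) continuous_on_const S, of 0] by metis
  obtain C where C: "v x0 \<le> ereal C" "C \<ge> 0"
  proof (cases "v x0")
    case (real r)
    then show ?thesis using that[of "max r 0"] by simp
  qed (use v(2)[of x0] that[of 0] in auto)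
  define f where "f n y = real_of_ereal (max (v y) (ereal (- real n)))" for n :: nat and y
  have f: "ereal (f n y) = max (v y) (ereal (- real n))" for n y
    using v(2)[of y] unfolding f_def by (cases "v y") (auto simp: max_def)
  have fC: "f n y \<le> C" if "y \<in> S" for n y
  proof -
    have "ereal (f n y) \<le> ereal C" unfolding f using x0(2)[OF that] C by (auto simp: zero_ereal_def[symmetric])
    then show ?thesis by simp
  qed
  have fdec: "f (Suc n) y \<le> f n y" for n y
  proof -
    have "ereal (f (Suc n) y) \<le> ereal (f n y)" unfolding f by (intro max.mono) auto
    then show ?thesis by simp
  qed
  define \<phi> where "\<phi> n x = (SUP y\<in>S. f n y - real n * dist x y)" for n x
  have le_C: "f n y - real n * dist x y \<le> C" if "y \<in> S" for n x y
    using fC[OF that, of n] by (smt (verit) mult_nonneg_nonneg of_nat_0_le_iff zero_le_dist)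
  have bdd: "bdd_above ((\<lambda>y. f n y - real n * dist x y) ` S)" for n x
    using le_C by (intro bdd_aboveI2) auto
  have up: "f n y - real n * dist x y \<le> \<phi> n x" if "y \<in> S" for n x y
    unfolding \<phi>_def using that bdd by (rule cSUP_upper)
  have least: "\<phi> n x \<le> t" if "\<And>y. y \<in> S \<Longrightarrow> f n y - real n * dist x y \<le> t" for n x t
    unfolding \<phi>_def using S(2) that by (rule cSUP_least)
  have lip: "\<phi> n x \<le> \<phi> n x' + real n * dist x x'" for n x x'
  proof (rule least)
    fix y assume "y \<in> S"
    have "real n * dist x' y \<le> real n * (dist x y + dist x x')"
      by (intro mult_left_mono) (auto simp: dist_triangle3 add.commute)
    then show "f n y - real n * dist x y \<le> \<phi> n x' + real n * dist x x'"
      using up[OF \<open>y \<in> S\<close>, of n x'] by (simp add: algebra_simps)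
  qed
  show ?thesis
  proof
    show "continuous_on UNIV (\<phi> n)" for n
    proof (rule lipschitz_on_continuous_on)
      show "(real n)-lipschitz_on UNIV (\<phi> n)"
      proof (rule lipschitz_onI)
        show "dist (\<phi> n x) (\<phi> n y) \<le> real n * dist x y" for x y
          using lip[of n x y] lip[of n y x] by (simp add: dist_real_def abs_le_iff dist_commute[of y x])
      qed simp
    qed
    show "\<phi> (Suc n) x \<le> \<phi> n x" for n x
    proof (rule least)
      fix y assume "y \<in> S"
      then show "f (Suc n) y - real (Suc n) * dist x y \<le> \<phi> n x"
        using up[of y n x] fdec[of n y] by (simp add: algebra_simps) (smt (verit) zero_le_dist)
    qed
    show ge: "v x \<le> ereal (\<phi> n x)" if "x \<in> S" for n x
    proof -
      have "v x \<le> ereal (f n x)" unfolding f by simp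
      also have "\<dots> \<le> ereal (\<phi> n x)" using up[OF that, of n x] by simp
      finally show ?thesis .
    qed
    show "(INF n. ereal (\<phi> n x)) = v x" if "x \<in> S" for x
    proof (rule antisym)
      show "v x \<le> (INF n. ereal (\<phi> n x))" using ge[OF that] by (intro INF_greatest)
      show "(INF n. ereal (\<phi> n x)) \<le> v x"
      proof (rule dense_ge)
        fix t assume "v x < t"
        then obtain s where s: "v x < ereal s" "ereal s < t" using ereal_dense2 by blast
        obtain d where d: "d > 0" "ball x d \<subseteq> {z. v z < ereal s}"
          using uscD[OF v(1), of "ereal s"] s(1) openE by blast
        obtain n :: nat where n: "real n \<ge> max (- s) ((C - s) / d)" using real_arch_simple by blast
        have "\<phi> n x \<le> s"
        proof (rule least)
          fix y assume y: "y \<in> S"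
          show "f n y - real n * dist x y \<le> s"
          proof (cases "dist x y < d")
            case True
            then have "ereal (f n y) \<le> ereal s" unfolding f using d n by (auto simp: subset_eq less_imp_le)
            then show ?thesis by (smt (verit) ereal_less_eq(3) mult_nonneg_nonneg of_nat_0_le_iff zero_le_dist)
          next
            case False
            have "C - s \<le> real n * d" using n d by (simp add: field_simps)
            also have "\<dots> \<le> real n * dist x y" using False by (intro mult_left_mono) auto
            finally show ?thesis using fC[OF y, of n] by simp
          qed
        qed
        then have "(INF n. ereal (\<phi> n x)) \<le> ereal s"
          by (intro INF_lower2[of n]) auto
        then show "(INF n. ereal (\<phi> n x)) \<le> t" using s by simp
      qed
    qed
  qed
qed

text \<open>On the unit circle \<open>cnj z\<close> equals \<open>1 / z\<close>, so a product of real parts of two monomials is again a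
  combination of such real parts. Hence the real parts of polynomials form an algebra there and the
  Stone--Weierstrass theorem applies. This solves the Dirichlet problem in a disc up to a small
  error.\<close>

lemma Re_poly_dense_unit_circle:
  fixes f :: "complex \<Rightarrow> real"
  assumes f: "continuous_on (sphere 0 1) f" and e: "e > 0"
  obtains p :: "complex poly" where "\<And>z. z \<in> sphere 0 1 \<Longrightarrow> \<bar>f z - Re (poly p z)\<bar> < e"
proof -
  define R where "R = {g. \<exists>p :: complex poly. \<forall>z\<in>sphere 0 1. g z = Re (poly p z)}"
  have add: "(\<lambda>x. g x + h x) \<in> R" if gh: "g \<in> R" "h \<in> R" for g h
  proof -
    obtain p q where "\<forall>z\<in>sphere 0 1. g z = Re (poly p z)" "\<forall>z\<in>sphere 0 1. h z = Re (poly q z)"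
      using gh unfolding R_def by auto
    then show ?thesis unfolding R_def by (auto intro!: exI[of _ "p + q"])
  qed
  have sum: "(\<lambda>x. \<Sum>i\<in>A. g i x) \<in> R" if "finite A" "\<And>i. i \<in> A \<Longrightarrow> g i \<in> R" for A :: "nat set" and g
    using that
  proof (induction A rule: finite_induct)
    case empty
    show ?case unfolding R_def by (auto intro!: exI[of _ 0])
  qed (auto intro!: add)
  have mono_mult: "(\<lambda>z. Re (a * z ^ i) * Re (b * z ^ j)) \<in> R" for a b i j
  proof -
    have half: "Re u * Re w = (Re (u * w) + Re (u * cnj w)) / 2" for u w by simp
    have conj: "\<exists>q. \<forall>z\<in>sphere 0 1. Re (a * z ^ i * cnj (b * z ^ j)) = Re (poly q z)"
    proof (cases "j \<le> i")
      case True
      have "a * z ^ i * cnj (b * z ^ j) = a * cnj b * z ^ (i - j)" if "z \<in> sphere 0 1" for z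
      proof -
        have "z * cnj z = 1" using that by (simp add: complex_norm_square[symmetric])
        then have 1: "z ^ j * cnj z ^ j = 1" by (metis power_mult_distrib power_one)
        have "z ^ i = z ^ (i - j) * z ^ j" using True by (simp add: power_add[symmetric])
        then have "a * z ^ i * cnj (b * z ^ j) = a * cnj b * z ^ (i - j) * (z ^ j * cnj z ^ j)" by simp
        then show ?thesis using 1 by simp
      qed
      then show ?thesis by (intro exI[of _ "monom (a * cnj b) (i - j)"] ballI) (simp only: poly_monom)
    next
      case False
      have "Re (a * z ^ i * cnj (b * z ^ j)) = Re (cnj a * b * z ^ (j - i))" if "z \<in> sphere 0 1" for z
      proof -
        have "z * cnj z = 1" using that by (simp add: complex_norm_square[symmetric])
        then have 1: "z ^ i * cnj z ^ i = 1" by (metis power_mult_distrib power_one)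
        have "z ^ j = z ^ (j - i) * z ^ i" using False by (simp add: power_add[symmetric])
        then have "cnj a * cnj z ^ i * (b * z ^ j) = cnj a * b * z ^ (j - i) * (z ^ i * cnj z ^ i)" by simp
        then have "cnj (a * z ^ i * cnj (b * z ^ j)) = cnj a * b * z ^ (j - i)" using 1 by simp
        then show ?thesis by (metis cnj.simps(1))
      qed
      then show ?thesis by (intro exI[of _ "monom (cnj a * b) (j - i)"] ballI) (simp only: poly_monom)
    qed
    then obtain q where q: "\<forall>z\<in>sphere 0 1. Re (a * z ^ i * cnj (b * z ^ j)) = Re (poly q z)" by blast
    have "Re (a * z ^ i) * Re (b * z ^ j) = Re (poly (smult (1/2) (monom (a * b) (i + j) + q)) z)"
      if "z \<in> sphere 0 1" for z
    proof -
      have "a * z ^ i * (b * z ^ j) = a * b * z ^ (i + j)" by (simp add: power_add)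
      moreover have "Re (a * z ^ i * cnj (b * z ^ j)) = Re (poly q z)" using q that by blast
      ultimately have "Re (a * z ^ i) * Re (b * z ^ j) = (Re (a * b * z ^ (i + j)) + Re (poly q z)) / 2"
        unfolding half[of "a * z ^ i" "b * z ^ j"] by presburger
      then show ?thesis by (simp only: poly_smult poly_add poly_monom) simp
    qed
    then show ?thesis unfolding R_def by blast
  qed
  have mult: "(\<lambda>x. g x * h x) \<in> R" if gh: "g \<in> R" "h \<in> R" for g h
  proof -
    obtain p q where pq: "\<forall>z\<in>sphere 0 1. g z = Re (poly p z)" "\<forall>z\<in>sphere 0 1. h z = Re (poly q z)"
      using gh unfolding R_def by auto
    have "(\<lambda>z. \<Sum>i\<in>{..degree p}. \<Sum>j\<in>{..degree q}. Re (coeff p i * z ^ i) * Re (coeff q j * z ^ j)) \<in> R"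
      by (intro sum mono_mult) auto
    moreover have "g z * h z = (\<Sum>i\<in>{..degree p}. \<Sum>j\<in>{..degree q}. Re (coeff p i * z ^ i) * Re (coeff q j * z ^ j))"
      if "z \<in> sphere 0 1" for z
      using pq that by (simp add: poly_altdef Re_sum sum_product del: times_complex.simps)
    ultimately show ?thesis unfolding R_def by auto
  qed
  interpret function_ring_on R "sphere 0 1"
  proof
    show "continuous_on (sphere 0 1) g" if "g \<in> R" for g
    proof -
      obtain p where p: "\<forall>z\<in>sphere 0 1. g z = Re (poly p z)" using \<open>g \<in> R\<close> unfolding R_def by blast
      have "continuous_on (sphere 0 1) (\<lambda>z. Re (poly p z))" by (intro continuous_intros)
      then show ?thesis by (rule continuous_on_eq) (use p in auto)
    qed
    show "(\<lambda>_. c) \<in> R" for c unfolding R_def by (auto intro!: exI[of _ "[:of_real c:]"])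
    show "\<exists>g\<in>R. g x \<noteq> g y" if "x \<noteq> y" for x y :: complex
    proof -
      have "Re \<in> R" unfolding R_def by (auto intro!: exI[of _ "[:0, 1:]"])
      moreover have "Im \<in> R" unfolding R_def by (auto intro!: exI[of _ "[:0, -\<i>:]"])
      ultimately show ?thesis using that complex_eq_iff by blast
    qed
  qed (use add mult in auto)
  obtain g where "g \<in> R" "\<forall>z\<in>sphere 0 1. \<bar>f z - g z\<bar> < e"
    using Stone_Weierstrass_basic[OF f e] by blast
  then show ?thesis using that unfolding R_def by fastforce
qed

lemma subharmonic_imp_circ_submean:
  assumes "subharmonic v" "r > 0"
  shows "circ_submean v c r"
  unfolding circ_submean_def
  using assms circle_mean_le_circ_avg[of _ v c r] unfolding subharmonic_def by (meson order_trans)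

lemma subharmonic_imp_loc_submean: "subharmonic v \<Longrightarrow> loc_submean v c"
  unfolding loc_submean_def by (auto intro: subharmonic_imp_circ_submean intro!: exI[of _ 1])

text \<open>Given a circle, let \<open>\<phi>\<close> be a continuous majorant of \<open>v\<close> on it and \<open>Re F\<close> a slightly larger
  harmonic polynomial. The maximum principle, applied with the local property, gives
  \<open>v \<le> Re F\<close> inside, and at the centre \<open>Re F\<close> is the mean of a function close to \<open>\<phi>\<close>. Letting
  \<open>\<phi>\<close> decrease to \<open>v\<close> gives the inequality on the given circle. All competitors constructed
  below are shown to be plurisubharmonic in this way.\<close>

theorem subharmonic_local:
  assumes v: "usc v" "\<And>z. v z < \<infinity>" and sub: "\<And>c. loc_submean v c"
  shows "subharmonic v"
  unfolding subharmonic_def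
proof (intro conjI allI impI v)
  fix c :: complex and r :: real
  assume r: "r > 0"
  have "c + of_real r \<in> sphere c r" using r by (simp add: dist_norm)
  then have "sphere c r \<noteq> {}" by blast
  from usc_decreasing_continuous_approximation[OF v compact_sphere this]
  obtain \<phi> where \<phi>: "\<And>n. continuous_on UNIV (\<phi> n)" "\<And>n x. \<phi> (Suc n) x \<le> \<phi> n x"
    "\<And>n x. x \<in> sphere c r \<Longrightarrow> v x \<le> ereal (\<phi> n x)"
    "\<And>x. x \<in> sphere c r \<Longrightarrow> (INF n. ereal (\<phi> n x)) = v x" by metis
  define \<psi> where "\<psi> n \<theta> = \<phi> n (c + of_real r * cis \<theta>)" for n \<theta>
  have on: "c + of_real r * cis \<theta> \<in> sphere c r" for \<theta>
    using r by (simp add: dist_norm norm_mult)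
  have \<psi>: "continuous_on A (\<psi> n)" for A n
    unfolding \<psi>_def by (rule continuous_on_compose2[OF \<phi>(1)]) (auto intro!: continuous_intros)
  show "v c \<le> circle_mean v c r"
  proof (rule le_circle_mean_decreasing_limit[of \<psi>])
    show "v c \<le> ereal (circ_avg (\<psi> n))" for n
    proof (rule ereal_le_epsilon2)
      fix e :: real
      assume e: "e > 0"
      have "continuous_on (sphere 0 1) (\<lambda>x. \<phi> n (c + of_real r * x) + e/2)"
        by (intro continuous_intros continuous_on_compose2[OF \<phi>(1)]) auto
      from Re_poly_dense_unit_circle[OF this half_gt_zero[OF e]]
      obtain p where p: "\<And>x. x \<in> sphere 0 1 \<Longrightarrow> \<bar>\<phi> n (c + of_real r * x) + e/2 - Re (poly p x)\<bar> < e/2"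
        by metis
      define F where "F z = poly p ((z - c) / of_real r)" for z
      have hol: "F holomorphic_on A" for A unfolding F_def by (intro holomorphic_intros) (use r in auto)
      have F: "\<phi> n (c + of_real r * x) \<le> Re (F (c + of_real r * x))"
              "Re (F (c + of_real r * x)) \<le> \<phi> n (c + of_real r * x) + e" if "x \<in> sphere 0 1" for x
      proof -
        have "F (c + of_real r * x) = poly p x" using r by (simp add: F_def)
        then show "\<phi> n (c + of_real r * x) \<le> Re (F (c + of_real r * x))"
          "Re (F (c + of_real r * x)) \<le> \<phi> n (c + of_real r * x) + e" using p[OF that] by (simp_all only: abs_less_iff) linarith+
      qed
      have "v c \<le> ereal (Re (F c))"
      proof (rule maximum_principle[OF v, of "ball c r"])
        show "continuous_on (closure (ball c r)) (\<lambda>z. Re (F z))"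
          using hol holomorphic_on_imp_continuous_on by (intro continuous_intros) blast
        show "loc_harmonic (\<lambda>z. Re (F z)) z" for z
          unfolding loc_harmonic_def using hol by (intro exI[of _ 1]) auto
        fix z assume "z \<in> closure (ball c r)" "z \<notin> ball c r"
        then have z: "z \<in> sphere c r" using r by auto
        define x where "x = (z - c) / of_real r"
        have "x \<in> sphere 0 1" "z = c + of_real r * x"
          using z r by (auto simp: x_def norm_divide dist_norm norm_minus_commute)
        then show "v z \<le> ereal (Re (F z))"
          using \<phi>(3)[OF z, of n] F(1)[of x] by (metis ereal_less_eq(3) order_trans)
      qed (use r sub in auto)
      also have "Re (F c) = circ_avg (\<lambda>\<theta>. Re (F (c + of_real r * cis \<theta>)))"
        using circ_avg_Re_holomorphic(2)[OF hol, of r "r + 1" c] r by simp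
      also have "\<dots> \<le> circ_avg (\<lambda>\<theta>. \<psi> n \<theta> + e)"
        unfolding circ_avg_def
      proof (intro divide_right_mono integral_le integrable_continuous_real)
        show "continuous_on {0..2*pi} (\<lambda>\<theta>. Re (F (c + of_real r * cis \<theta>)))"
          using circ_avg_Re_holomorphic(1)[OF hol, of r "r + 1" c] r by simp
        show "Re (F (c + complex_of_real r * cis \<theta>)) \<le> \<psi> n \<theta> + e" for \<theta>
          using F(2)[of "cis \<theta>"] by (simp add: \<psi>_def)
      qed (auto intro!: continuous_intros \<psi>)
      also have "circ_avg (\<lambda>\<theta>. \<psi> n \<theta> + e) = circ_avg (\<psi> n) + e"
        unfolding circ_avg_def using integrable_continuous_real[OF \<psi>]
        by (subst integral_add) (auto simp: add_divide_distrib)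
      finally show "v c \<le> ereal (circ_avg (\<psi> n)) + ereal e" by simp
    qed
  qed (use \<phi> \<psi> on in \<open>auto simp: \<psi>_def\<close>)
qed

section \<open>Rules for the local properties\<close>

text \<open>The rule behind maxima and glued functions: it suffices to find a sub-mean minorant that
  agrees with \<open>w\<close> at the centre.\<close>

lemma loc_submean_minorant:
  assumes u: "loc_submean u c" and R: "R > 0" and c: "w c \<le> u c" and le: "\<And>z. z \<in> ball c R \<Longrightarrow> u z \<le> w z"
  shows "loc_submean w c"
proof -
  obtain R' where R': "R' > 0" "\<And>r. 0 < r \<Longrightarrow> r < R' \<Longrightarrow> circ_submean u c r"
    using u by (auto simp: loc_submean_def)
  have "circ_submean w c r" if r: "0 < r" "r < min R R'" for r
    unfolding circ_submean_def
  proof (intro allI impI)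
    fix \<phi> assume \<phi>: "continuous_on {0..2*pi} \<phi>" "\<forall>\<theta>\<in>{0..2*pi}. w (c + of_real r * cis \<theta>) \<le> ereal (\<phi> \<theta>)"
    have "c + of_real r * cis \<theta> \<in> ball c R" for \<theta> using r by (simp add: dist_norm norm_mult)
    then have "u (c + of_real r * cis \<theta>) \<le> ereal (\<phi> \<theta>)" if "\<theta> \<in> {0..2*pi}" for \<theta>
      using le \<phi>(2) that order_trans by blast
    then have "u c \<le> ereal (circ_avg \<phi>)"
      using R'(2)[of r] r \<phi>(1) by (auto simp: circ_submean_def)
    then show "w c \<le> ereal (circ_avg \<phi>)" using c by (rule order_trans[rotated])
  qed
  then show ?thesis unfolding loc_submean_def using R R' by (intro exI[of _ "min R R'"]) auto
qed

lemma loc_submean_bot: "v c = -\<infinity> \<Longrightarrow> loc_submean v c"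
  by (auto simp: loc_submean_def circ_submean_def intro!: exI[of _ 1])

lemma loc_submean_add_harmonic:
  assumes u: "loc_submean u c" and h: "loc_harmonic h c"
  shows "loc_submean (\<lambda>z. u z + ereal (h z)) c"
proof -
  obtain R1 where R1: "R1 > 0" "\<And>r. 0 < r \<Longrightarrow> r < R1 \<Longrightarrow> circ_submean u c r"
    using u by (auto simp: loc_submean_def)
  obtain R2 F where R2: "R2 > 0" "F holomorphic_on ball c R2" "\<And>z. z \<in> ball c R2 \<Longrightarrow> h z = Re (F z)"
    using h by (auto simp: loc_harmonic_def)
  have "circ_submean (\<lambda>z. u z + ereal (h z)) c r" if r: "0 < r" "r < min R1 R2" for r
    unfolding circ_submean_def
  proof (intro allI impI)
    fix \<phi> assume \<phi>: "continuous_on {0..2*pi} \<phi>"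
      "\<forall>\<theta>\<in>{0..2*pi}. u (c + of_real r * cis \<theta>) + ereal (h (c + of_real r * cis \<theta>)) \<le> ereal (\<phi> \<theta>)"
    define g where "g \<theta> = Re (F (c + of_real r * cis \<theta>))" for \<theta>
    have g: "continuous_on {0..2*pi} g" "circ_avg g = h c"
      using circ_avg_Re_holomorphic[OF R2(2), of r] r R2(1) R2(3)[of c] unfolding g_def by auto
    have "c + of_real r * cis \<theta> \<in> ball c R2" for \<theta> using r by (simp add: dist_norm norm_mult)
    then have "u (c + of_real r * cis \<theta>) \<le> ereal (\<phi> \<theta> - g \<theta>)" if "\<theta> \<in> {0..2*pi}" for \<theta>
      using \<phi>(2) R2(3)[of "c + of_real r * cis \<theta>"] that unfolding g_def
      by (cases "u (c + of_real r * cis \<theta>)") fastforce+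
    then have "u c \<le> ereal (circ_avg (\<lambda>\<theta>. \<phi> \<theta> - g \<theta>))"
      using R1(2)[of r] r \<phi>(1) g(1) by (auto simp: circ_submean_def intro!: continuous_intros)
    also have "circ_avg (\<lambda>\<theta>. \<phi> \<theta> - g \<theta>) = circ_avg \<phi> - h c"
      unfolding g(2)[symmetric] unfolding circ_avg_def
      using integrable_continuous_real[OF \<phi>(1)] integrable_continuous_real[OF g(1)]
      by (subst integral_diff) (auto simp: diff_divide_distrib)
    finally show "u c + ereal (h c) \<le> ereal (circ_avg \<phi>)" by (cases "u c") auto
  qed
  then show ?thesis unfolding loc_submean_def using R1 R2 by (intro exI[of _ "min R1 R2"]) auto
qed

lemma loc_harmonic_const: "loc_harmonic (\<lambda>_. k) c"
  unfolding loc_harmonic_def by (auto intro!: exI[of _ 1] exI[of _ "\<lambda>_. of_real k"])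

lemma loc_harmonic_add:
  assumes "loc_harmonic h c" "loc_harmonic k c"
  shows "loc_harmonic (\<lambda>z. h z + k z) c"
proof -
  obtain R F where R: "R > 0" "F holomorphic_on ball c R" "\<And>z. z \<in> ball c R \<Longrightarrow> h z = Re (F z)"
    using assms(1) unfolding loc_harmonic_def by blast
  obtain S G where S: "S > 0" "G holomorphic_on ball c S" "\<And>z. z \<in> ball c S \<Longrightarrow> k z = Re (G z)"
    using assms(2) unfolding loc_harmonic_def by blast
  have "(\<lambda>z. F z + G z) holomorphic_on ball c (min R S)"
    by (intro holomorphic_intros holomorphic_on_subset[OF R(2)] holomorphic_on_subset[OF S(2)]) auto
  then show ?thesis unfolding loc_harmonic_def using R S
    by (intro exI[of _ "min R S"]) (auto intro!: exI[of _ "\<lambda>z. F z + G z"])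
qed

lemma loc_harmonic_cmult:
  assumes "loc_harmonic h c"
  shows "loc_harmonic (\<lambda>z. m * h z) c"
proof -
  obtain R F where R: "R > 0" "F holomorphic_on ball c R" "\<And>z. z \<in> ball c R \<Longrightarrow> h z = Re (F z)"
    using assms(1) unfolding loc_harmonic_def by blast
  have "(\<lambda>z. of_real m * F z) holomorphic_on ball c R" by (intro holomorphic_intros R)
  then show ?thesis unfolding loc_harmonic_def using R
    by (intro exI[of _ R]) (auto intro!: exI[of _ "\<lambda>z. of_real m * F z"])
qed

text \<open>Where the affine function does not vanish, its quotient by the value at \<open>c\<close> stays in the
  right half plane near \<open>c\<close>, so the principal logarithm applies to it.\<close>

lemma loc_harmonic_ln_affine:
  assumes "\<alpha> + c * \<beta> \<noteq> 0"
  shows "loc_harmonic (\<lambda>\<zeta>. ln (cmod (\<alpha> + \<zeta> * \<beta>))) c"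
proof -
  define A where "A = \<alpha> + c * \<beta>"
  have A: "A \<noteq> 0" using assms by (simp add: A_def)
  define R where "R = cmod A / (cmod \<beta> + 1)"
  have R: "R > 0" using A by (auto simp: R_def intro!: divide_pos_pos add_nonneg_pos)
  define F where "F \<zeta> = Ln (1 + (\<zeta> - c) * \<beta> / A) + of_real (ln (cmod A))" for \<zeta>
  have small: "Re (1 + (\<zeta> - c) * \<beta> / A) > 0" if "\<zeta> \<in> ball c R" for \<zeta>
  proof -
    have "cmod (\<zeta> - c) * cmod \<beta> \<le> cmod (\<zeta> - c) * (cmod \<beta> + 1)" by (intro mult_left_mono) auto
    also have "\<dots> < R * (cmod \<beta> + 1)" using that by (intro mult_strict_right_mono) (auto simp: dist_norm norm_minus_commute add_nonneg_pos)
    also have "\<dots> = cmod A" unfolding R_def by (simp add: add_nonneg_eq_0_iff)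
    finally have "cmod ((\<zeta> - c) * \<beta> / A) < 1" using A by (simp add: norm_mult norm_divide)
    then show ?thesis using abs_Re_le_cmod[of "(\<zeta> - c) * \<beta> / A"] by simp
  qed
  have "F holomorphic_on ball c R" unfolding F_def
  proof (intro holomorphic_intros)
    show "1 + (\<zeta> - c) * \<beta> / A \<notin> \<real>\<^sub>\<le>\<^sub>0" if "\<zeta> \<in> ball c R" for \<zeta>
      using small[OF that] by (auto simp: complex_nonpos_Reals_iff)
  qed (use A in auto)
  moreover have "ln (cmod (\<alpha> + \<zeta> * \<beta>)) = Re (F \<zeta>)" if "\<zeta> \<in> ball c R" for \<zeta>
  proof -
    have ne: "1 + (\<zeta> - c) * \<beta> / A \<noteq> 0" using small[OF that] by (metis less_irrefl zero_complex.simps(1))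
    have "\<alpha> + \<zeta> * \<beta> = A * (1 + (\<zeta> - c) * \<beta> / A)" using A by (simp add: A_def field_simps)
    then have "ln (cmod (\<alpha> + \<zeta> * \<beta>)) = ln (cmod A) + ln (cmod (1 + (\<zeta> - c) * \<beta> / A))"
      using A ne by (simp add: norm_mult ln_mult)
    then show ?thesis using ne by (simp add: F_def)
  qed
  ultimately show ?thesis unfolding loc_harmonic_def using R by blast
qed

lemma loc_submean_cmult:
  assumes "loc_submean u c" "m > 0"
  shows "loc_submean (\<lambda>z. ereal m * u z) c"
proof -
  obtain R where R: "R > 0" "\<And>r. 0 < r \<Longrightarrow> r < R \<Longrightarrow> circ_submean u c r"
    using assms by (auto simp: loc_submean_def)
  have "circ_submean (\<lambda>z. ereal m * u z) c r" if r: "0 < r" "r < R" for r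
    unfolding circ_submean_def
  proof (intro allI impI)
    fix \<phi> assume \<phi>: "continuous_on {0..2*pi} \<phi>"
      "\<forall>\<theta>\<in>{0..2*pi}. ereal m * u (c + of_real r * cis \<theta>) \<le> ereal (\<phi> \<theta>)"
    have "u (c + of_real r * cis \<theta>) \<le> ereal (\<phi> \<theta> / m)" if "\<theta> \<in> {0..2*pi}" for \<theta>
      using \<phi>(2) that assms(2)
      by (cases "u (c + of_real r * cis \<theta>)") (fastforce simp: field_simps)+
    moreover have "continuous_on {0..2*pi} (\<lambda>\<theta>. \<phi> \<theta> / m)"
      using \<phi>(1) assms(2) by (auto intro!: continuous_intros)
    ultimately have "u c \<le> ereal (circ_avg (\<lambda>\<theta>. \<phi> \<theta> / m))"
      using R(2)[of r] r unfolding circ_submean_def by blast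
    also have "circ_avg (\<lambda>\<theta>. \<phi> \<theta> / m) = circ_avg \<phi> / m" by (simp add: circ_avg_def)
    finally show "ereal m * u c \<le> ereal (circ_avg \<phi>)" using assms(2)
      by (cases "u c") (auto simp: field_simps)
  qed
  then show ?thesis unfolding loc_submean_def using R by blast
qed

lemma loc_submean_const: "loc_submean (\<lambda>_. k) c"
proof (cases k)
  case (real x)
  have "circ_submean (\<lambda>_. ereal x) c r" for r
    unfolding circ_submean_def
  proof (intro allI impI)
    fix \<phi> assume \<phi>: "continuous_on {0..2*pi} \<phi>" "\<forall>\<theta>\<in>{0..2*pi}. ereal x \<le> ereal (\<phi> \<theta>)"
    have "integral {0..2*pi} (\<lambda>_. x) \<le> integral {0..2*pi} \<phi>"
      using \<phi> by (intro integral_le integrable_continuous_real) auto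
    then show "ereal x \<le> ereal (circ_avg \<phi>)" by (simp add: circ_avg_def field_simps)
  qed
  then show ?thesis using real by (auto simp: loc_submean_def intro!: exI[of _ 1])
next
  case PInf
  have "circ_submean (\<lambda>_. \<infinity>) c r" for r
    unfolding circ_submean_def using pi_gt_zero by (auto intro!: exI[of _ 0])
  then show ?thesis using PInf by (auto simp: loc_submean_def intro!: exI[of _ 1])
qed (auto intro: loc_submean_bot)

section \<open>The Bernstein--Walsh inequality\<close>

text \<open>Comparison with \<open>m + (d + e') ln (|z| / \<rho>)\<close> on a large annulus: the extra \<open>e'\<close> beats the
  unknown constant \<open>C\<close> on the outer circle, and then \<open>e'\<close> tends to \<open>0\<close>.\<close>

proposition Bernstein_Walsh:
  assumes v: "subharmonic v" and d: "d \<ge> 0" and growth: "\<And>z. v z \<le> ereal (d * log_plus (cmod z) + C)"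
    and \<rho>: "\<rho> > 0" and m: "\<And>z. cmod z \<le> \<rho> \<Longrightarrow> v z \<le> ereal m" and z: "cmod z \<ge> \<rho>"
  shows "v z \<le> ereal (m + d * ln (cmod z / \<rho>))"
proof (cases "cmod z = \<rho>")
  case True
  then show ?thesis using m[of z] \<rho> by simp
next
  case False
  then have z: "\<rho> < cmod z" using z by simp
  show ?thesis
  proof (rule ereal_le_epsilon2)
    fix e :: real
    assume e: "e > 0"
    define e' where "e' = e / ln (cmod z / \<rho>)"
    have lz: "ln (cmod z / \<rho>) > 0" using z \<rho> by (intro ln_gt_zero) simp
    then have e': "e' > 0" using e by (simp add: e'_def)
    \<comment> \<open>\<open>R\<close> is so large that the growth bound is below the comparison function on \<open>|x| = R\<close>\<close>
    define R where "R = max (cmod z + 1) (max 1 (exp ((C - m) / e' + (d + e') / e' * ln \<rho>)))"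
    have R: "cmod z < R" "1 \<le> R" by (auto simp: R_def)
    have "(C - m) / e' + (d + e') / e' * ln \<rho> \<le> ln R"
    proof -
      have "exp ((C - m) / e' + (d + e') / e' * ln \<rho>) \<le> R" by (simp add: R_def)
      then show ?thesis by (subst ln_ge_iff) (use R in auto)
    qed
    then have "((C - m) / e' + (d + e') / e' * ln \<rho>) * e' \<le> ln R * e'" using e' by (intro mult_right_mono) auto
    moreover have "((C - m) / e' + (d + e') / e' * ln \<rho>) * e' = C - m + (d + e') * ln \<rho>"
      using e' by (simp add: field_simps)
    ultimately have big: "C + d * ln R \<le> m + (d + e') * (ln R - ln \<rho>)"
      using e' by (simp add: algebra_simps)
    define h where "h x = m + (d + e') * (ln (cmod x) - ln \<rho>)" for x
    define U where "U = ball (0::complex) R - cball 0 \<rho>"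
    have cl: "closure U \<subseteq> cball 0 R - ball 0 \<rho>"
      by (rule closure_minimal) (auto simp: U_def intro!: closed_Diff)
    have "v z \<le> ereal (h z)"
    proof (rule maximum_principle[of v U h])
      show "usc v" "v z < \<infinity>" for z using v by (auto simp: subharmonic_def)
      show "open U" "bounded U" by (auto simp: U_def intro!: bounded_diff)
      show "loc_submean v c" for c by (rule subharmonic_imp_loc_submean[OF v])
      show "continuous_on (closure U) h" unfolding h_def
        by (intro continuous_intros) (use cl \<rho> in auto)
      show "loc_harmonic h c" if "c \<in> U" for c
      proof -
        have "loc_harmonic (\<lambda>x. (m - (d + e') * ln \<rho>) + (d + e') * ln (cmod (0 + x * 1))) c"
          using that \<rho> by (intro loc_harmonic_add loc_harmonic_const loc_harmonic_cmult loc_harmonic_ln_affine) (auto simp: U_def)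
        then show ?thesis unfolding h_def by (simp add: algebra_simps)
      qed
      show "z \<in> U" using z R by (auto simp: U_def)
      fix x assume x: "x \<in> closure U" "x \<notin> U"
      then have "cmod x \<le> \<rho> \<or> cmod x = R" "cmod x \<ge> \<rho>" using cl by (fastforce simp: U_def)+
      then consider "cmod x = \<rho>" | "cmod x = R" by linarith
      then show "v x \<le> ereal (h x)"
      proof cases
        case 1
        then show ?thesis using m[of x] by (simp add: h_def)
      next
        case 2
        have "v x \<le> ereal (d * log_plus (cmod x) + C)" by (rule growth)
        also have "\<dots> \<le> ereal (h x)" using 2 big R by (simp add: h_def log_plus_def)
        finally show ?thesis .
      qed
    qed
    also have "h z = m + d * ln (cmod z / \<rho>) + e"
    proof -
      have "ln (cmod z / \<rho>) = ln (cmod z) - ln \<rho>" using z \<rho> by (subst ln_div) auto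
      moreover have "e' * ln (cmod z / \<rho>) = e" using lz by (simp add: e'_def)
      ultimately show ?thesis unfolding h_def by (metis add.assoc distrib_right)
    qed
    finally show "v z \<le> ereal (m + d * ln (cmod z / \<rho>)) + ereal e" by simp
  qed
qed

section \<open>Closure properties of the Lelong classes\<close>

lemma psh_usc: "psh u \<Longrightarrow> usc u"
  and psh_less_infinity: "psh u \<Longrightarrow> u z < \<infinity>"
  and psh_line: "psh u \<Longrightarrow> subharmonic (\<lambda>\<zeta>. u (a + \<zeta> *s b))"
proof -
  assume u: "psh u"
  show "usc u" "subharmonic (\<lambda>\<zeta>. u (a + \<zeta> *s b))" using u by (auto simp: psh_def)
  have "subharmonic (\<lambda>\<zeta>. u (z + \<zeta> *s 0))" using u unfolding psh_def by blast
  then show "u z < \<infinity>" by (simp add: subharmonic_def)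
qed

lemma continuous_on_vector_scalar_mult [continuous_intros]:
  fixes f :: "'a::topological_space \<Rightarrow> complex" and g :: "'a \<Rightarrow> complex^'n"
  assumes "continuous_on S f" "continuous_on S g"
  shows "continuous_on S (\<lambda>x. f x *s g x)"
  unfolding vector_scalar_mult_def
  by (intro continuous_on_vec_lambda continuous_intros assms)

lemma usc_compose_continuous:
  assumes "usc u" "continuous_on UNIV g"
  shows "usc (\<lambda>x. u (g x))"
  using assms open_vimage[of "{x. u x < t}" g for t]
  by (auto simp: usc_def vimage_def)

text \<open>It is enough to test the local property at the parameter \<open>0\<close> of every line, since
  the base point of the line may be moved.\<close>

lemma psh_local:
  fixes u :: "complex^'n \<Rightarrow> ereal"
  assumes "usc u" "\<And>z. u z < \<infinity>" "u z0 \<noteq> -\<infinity>"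
    and sub: "\<And>a b. loc_submean (\<lambda>\<zeta>. u (a + \<zeta> *s b)) 0"
  shows "psh u"
  unfolding psh_def
proof (intro conjI allI)
  fix a b
  show "subharmonic (\<lambda>\<zeta>. u (a + \<zeta> *s b))"
  proof (rule subharmonic_local)
    show "usc (\<lambda>\<zeta>. u (a + \<zeta> *s b))"
      by (rule usc_compose_continuous[OF assms(1)]) (intro continuous_intros)
    fix c
    have "loc_submean (\<lambda>\<zeta>. u ((a + c *s b) + \<zeta> *s b)) 0" by (rule sub)
    then show "loc_submean (\<lambda>\<zeta>. u (a + \<zeta> *s b)) c"
      by (simp add: loc_submean_def circ_submean_def vector_sadd_rdistrib add.assoc)
  qed (rule assms)
qed (use assms in auto)

lemma psh_loc_submean: "psh u \<Longrightarrow> loc_submean (\<lambda>\<zeta>. u (a + \<zeta> *s b)) 0"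
  by (intro subharmonic_imp_loc_submean psh_line)

lemma usc_add:
  assumes f: "usc f" and g: "usc g" and "\<And>x. f x < \<infinity>" "\<And>x. g x < \<infinity>"
  shows "usc (\<lambda>x. f x + g x)"
  unfolding usc_def
proof
  fix t
  have "f x + g x < t \<longleftrightarrow> (\<exists>s::real. f x < ereal s \<and> g x < t - ereal s)" for x
  proof
    assume *: "f x + g x < t"
    show "\<exists>s::real. f x < ereal s \<and> g x < t - ereal s"
    proof (cases "g x")
      case (real r)
      then have "f x < t - ereal r" using * by (simp add: ereal_less_minus)
      then obtain s where "f x < ereal s" "ereal s < t - ereal r" using ereal_dense2 by blast
      then show ?thesis using real by (intro exI[of _ s]) (auto simp: ereal_less_minus add.commute)
    next
      case MInf
      obtain s where s: "f x < ereal s" using assms(3)[of x] ereal_dense2 by blast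
      have "t \<noteq> -\<infinity>" using * by auto
      then show ?thesis using MInf s by (intro exI[of _ s]) (cases t; auto)
    qed (use assms(4)[of x] in auto)
  next
    assume "\<exists>s::real. f x < ereal s \<and> g x < t - ereal s"
    then obtain s where s: "f x < ereal s" "g x + ereal s < t" by (auto simp: ereal_less_minus)
    have "f x + g x \<le> ereal s + g x" using s(1) by (intro add_mono) auto
    then show "f x + g x < t" using s(2) by (simp add: add.commute)
  qed
  then have "{x. f x + g x < t} = (\<Union>s::real. {x. f x < ereal s} \<inter> {x. g x < t - ereal s})" by auto
  also have "open \<dots>" by (intro open_UN ballI open_Int uscD f g)
  finally show "open {x. f x + g x < t}" .
qed

lemma usc_cmult:
  assumes f: "usc f" and m: "m > 0"
  shows "usc (\<lambda>x. ereal m * f x)"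
  unfolding usc_def
proof
  fix t
  have "{x. ereal m * f x < t} = {x. f x < t / ereal m}"
    using m by (simp add: ereal_less_divide_pos mult.commute)
  then show "open {x. ereal m * f x < t}" using uscD[OF f] by simp
qed

lemma usc_continuous: "continuous_on UNIV k \<Longrightarrow> usc (\<lambda>x. ereal (k x))"
  unfolding usc_def by (auto intro!: open_Collect_less continuous_intros)

lemma psh_add_const: "psh u \<Longrightarrow> psh (\<lambda>z. u z + ereal k)"
proof -
  assume u: "psh u"
  then obtain z0 where z0: "u z0 \<noteq> -\<infinity>" by (auto simp: psh_def)
  show ?thesis
  proof (rule psh_local[of _ z0])
    show "usc (\<lambda>z. u z + ereal k)"
      by (intro usc_add psh_usc[OF u] usc_continuous continuous_intros psh_less_infinity[OF u]) auto
    show "loc_submean (\<lambda>\<zeta>. u (a + \<zeta> *s b) + ereal k) 0" for a b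
      by (intro loc_submean_add_harmonic psh_loc_submean u loc_harmonic_const)
    show "u z + ereal k < \<infinity>" for z using psh_less_infinity[OF u, of z] by (cases "u z") auto
    show "u z0 + ereal k \<noteq> -\<infinity>" using z0 by (cases "u z0") auto
  qed
qed

lemma psh_cmult: 
  assumes u: "psh u" and m: "m > 0"
  shows "psh (\<lambda>z. ereal m * u z)"
proof -
  obtain z0 where z0: "u z0 \<noteq> -\<infinity>" using u by (auto simp: psh_def)
  show ?thesis
  proof (rule psh_local[of _ z0])
    show "usc (\<lambda>z. ereal m * u z)"
      by (intro usc_cmult psh_usc u m)
    show "loc_submean (\<lambda>\<zeta>. ereal m * u (a + \<zeta> *s b)) 0" for a b
      by (intro loc_submean_cmult psh_loc_submean u m)
    show "ereal m * u z < \<infinity>" for z using psh_less_infinity[OF u, of z] m by (cases "u z") auto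
    show "ereal m * u z0 \<noteq> -\<infinity>" using z0 m psh_less_infinity[OF u, of z0] by (cases "u z0") auto
  qed
qed

definition elog :: "real \<Rightarrow> ereal" where
  "elog x = (if x \<le> 0 then -\<infinity> else ereal (ln x))"

lemma elog_less_iff: "elog x < ereal t \<longleftrightarrow> x < exp t"
proof (cases "x \<le> 0")
  case True
  then show ?thesis by (simp add: elog_def) (meson exp_gt_zero le_less_trans)
next
  case False
  then show ?thesis by (simp add: elog_def) (metis exp_less_cancel_iff exp_ln not_le)
qed

lemma elog_less_infinity: "elog x < \<infinity>" by (simp add: elog_def)

lemma usc_elog:
  assumes "continuous_on UNIV k"
  shows "usc (\<lambda>x. elog (k x))"
  unfolding usc_def
proof
  fix t
  show "open {x. elog (k x) < t}"
  proof (cases t)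
    case (real r)
    then show ?thesis by (auto simp: elog_less_iff intro!: open_Collect_less assms continuous_intros)
  next
    case PInf
    have "{x. elog (k x) < \<infinity>} = UNIV" using elog_less_infinity by blast
    then show ?thesis using PInf by simp
  qed auto
qed

text \<open>There are two cases for the local property: at the pole the value is \<open>-\<infinity>\<close>, and
  elsewhere the logarithm is locally harmonic along each line. Besides, the sum
  must not be identically \<open>-\<infinity>\<close>; by the sub-mean property, \<open>u\<close> is finite somewhere off the pole set.\<close>

lemma psh_add_log:
  fixes u :: "complex^'n \<Rightarrow> ereal"
  assumes u: "psh u" and m: "m > 0"
  shows "psh (\<lambda>p. u p + ereal m * elog (cmod (p $ i - q)))"
proof -
  let ?w = "\<lambda>p. u p + ereal m * elog (cmod (p $ i - q))"
  obtain z0 where z0: "u z0 \<noteq> -\<infinity>" using u by (auto simp: psh_def)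
  obtain z1 where z1: "u z1 \<noteq> -\<infinity>" "z1 $ i \<noteq> q"
  proof (cases "z0 $ i = q")
    case True
    have "\<exists>\<zeta>. cmod \<zeta> = 1 \<and> u (z0 + \<zeta> *s axis i 1) \<noteq> -\<infinity>"
    proof (rule ccontr)
      assume "\<not> ?thesis"
      then have bot: "u (z0 + \<zeta> *s axis i 1) = -\<infinity>" if "cmod \<zeta> = 1" for \<zeta> using that by blast
      have sub: "circ_submean (\<lambda>\<zeta>. u (z0 + \<zeta> *s axis i 1)) 0 1"
        by (intro subharmonic_imp_circ_submean psh_line u) auto
      have "u z0 \<le> ereal (circ_avg (\<lambda>_. x))" for x
        using sub[unfolded circ_submean_def, rule_format, of "\<lambda>_. x"] bot by (auto simp: norm_mult)
      then have "u z0 \<le> ereal x" for x by (simp add: circ_avg_def)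
      then show False using z0 by (metis ereal_bot)
    qed
    then obtain \<zeta> where "cmod \<zeta> = 1" "u (z0 + \<zeta> *s axis i 1) \<noteq> -\<infinity>" by blast
    moreover have "\<zeta> \<noteq> 0" using \<open>cmod \<zeta> = 1\<close> by auto
    ultimately show ?thesis using that[of "z0 + \<zeta> *s axis i 1"] True by simp
  qed (use z0 that in auto)
  have lt: "?w p < \<infinity>" for p
    using psh_less_infinity[OF u, of p] m by (cases "u p") (auto simp: elog_def)
  show ?thesis
  proof (rule psh_local[of _ z1])
    show "usc ?w"
    proof (rule usc_add)
      show "usc (\<lambda>p :: complex^'n. ereal m * elog (cmod (p $ i - q)))"
        by (rule usc_cmult[OF usc_elog m]) (intro continuous_intros)
      show "ereal m * elog (cmod (p $ i - q)) < \<infinity>" for p :: "complex^'n"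
        using m by (simp add: elog_def)
    qed (rule psh_usc[OF u], rule psh_less_infinity[OF u])
    show "?w z1 \<noteq> -\<infinity>" using z1 m by (cases "u z1") (auto simp: elog_def)
    show "loc_submean (\<lambda>\<zeta>. ?w (a + \<zeta> *s b)) 0" for a b
    proof (cases "a $ i = q")
      case True
      have "u a \<noteq> \<infinity>" using psh_less_infinity[OF u, of a] by simp
      then have "?w a = -\<infinity>" using True m by (simp add: elog_def)
      then show ?thesis by (intro loc_submean_bot) simp
    next
      case False
      have har: "loc_harmonic (\<lambda>\<zeta>. m * ln (cmod ((a $ i - q) + \<zeta> * b $ i))) 0"
        by (intro loc_harmonic_cmult loc_harmonic_ln_affine) (use False in auto)
      have v: "loc_submean (\<lambda>\<zeta>. u (a + \<zeta> *s b) + ereal (m * ln (cmod ((a $ i - q) + \<zeta> * b $ i)))) 0" (is "loc_submean ?v 0")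
        by (intro loc_submean_add_harmonic psh_loc_submean u har)
      define R where "R = cmod (a $ i - q) / (cmod (b $ i) + 1)"
      have R: "R > 0" using False unfolding R_def by (intro divide_pos_pos) (auto simp: add_nonneg_pos)
      have eq: "?v \<zeta> = ?w (a + \<zeta> *s b)" if "\<zeta> \<in> ball 0 R" for \<zeta>
      proof -
        have "cmod \<zeta> * cmod (b $ i) \<le> cmod \<zeta> * (cmod (b $ i) + 1)" by (intro mult_left_mono) auto
        also have "\<dots> < R * (cmod (b $ i) + 1)" using that by (intro mult_strict_right_mono) (auto simp: add_nonneg_pos)
        also have "\<dots> = cmod (a $ i - q)" unfolding R_def by (simp add: add_nonneg_eq_0_iff)
        finally have "(a $ i - q) + \<zeta> * b $ i \<noteq> 0"
          using norm_minus_cancel[of "\<zeta> * b $ i"] by (auto simp: norm_mult add_eq_0_iff2)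
        then show ?thesis by (simp add: elog_def algebra_simps)
      qed
      show ?thesis
        by (rule loc_submean_minorant[OF v R]) (use R in \<open>simp_all only: eq centre_in_ball\<close>)
    qed
  qed (rule lt)
qed

lemma LelongI: "psh u \<Longrightarrow> (\<And>z. u z \<le> ereal (\<delta> * log_plus (norm z) + C)) \<Longrightarrow> u \<in> Lelong \<delta>"
  by (auto simp: Lelong_def)

lemma log_plus_nonneg: "log_plus t \<ge> 0" by (simp add: log_plus_def)

lemma log_plus_mono: "0 \<le> s \<Longrightarrow> s \<le> t \<Longrightarrow> log_plus s \<le> log_plus t"
  by (cases "s \<le> 1"; cases "s = 0") (auto simp: log_plus_def max_def)

lemma Lelong_mono: "u \<in> Lelong \<delta> \<Longrightarrow> \<delta> \<le> \<delta>' \<Longrightarrow> u \<in> Lelong \<delta>'"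
proof -
  assume u: "u \<in> Lelong \<delta>" and "\<delta> \<le> \<delta>'"
  then have "\<delta> * log_plus (norm z) + C \<le> \<delta>' * log_plus (norm z) + C" for z :: "complex^'a" and C
    by (simp add: mult_right_mono log_plus_nonneg)
  then have "ereal (\<delta> * log_plus (norm z) + C) \<le> ereal (\<delta>' * log_plus (norm z) + C)" for z :: "complex^'a" and C
    by simp
  then show ?thesis using u unfolding Lelong_def by (blast intro: order_trans)
qed

lemma Lelong_add_const: "u \<in> Lelong \<delta> \<Longrightarrow> (\<lambda>z. u z + ereal k) \<in> Lelong \<delta>"
proof -
  assume u: "u \<in> Lelong \<delta>"
  then obtain C where C: "\<And>z. u z \<le> ereal (\<delta> * log_plus (norm z) + C)" by (auto simp: Lelong_def)
  show ?thesis
  proof (rule LelongI[where C = "C + k"])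
    show "psh (\<lambda>z. u z + ereal k)" using u by (auto simp: Lelong_def intro: psh_add_const)
    show "u z + ereal k \<le> ereal (\<delta> * log_plus (norm z) + (C + k))" for z
      using add_right_mono[OF C[of z], of "ereal k"] by (simp add: algebra_simps)
  qed
qed

lemma Lelong_cmult:
  assumes u: "u \<in> Lelong \<delta>" and m: "m > 0"
  shows "(\<lambda>z. ereal m * u z) \<in> Lelong (m * \<delta>)"
proof -
  obtain C where C: "\<And>z. u z \<le> ereal (\<delta> * log_plus (norm z) + C)" using u by (auto simp: Lelong_def)
  show ?thesis
  proof (rule LelongI[where C = "m * C"])
    show "psh (\<lambda>z. ereal m * u z)" using u m by (auto simp: Lelong_def intro: psh_cmult)
    show "ereal m * u z \<le> ereal (m * \<delta> * log_plus (norm z) + m * C)" for z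
      using ereal_mult_left_mono[OF C[of z], of "ereal m"] m by (simp add: algebra_simps)
  qed
qed

lemma Lelong_add_log:
  fixes u :: "complex^'n \<Rightarrow> ereal"
  assumes u: "u \<in> Lelong \<delta>" and m: "m > 0"
  shows "(\<lambda>p. u p + ereal m * elog (cmod (p $ i - q))) \<in> Lelong (\<delta> + m)"
proof -
  obtain C where C: "\<And>z. u z \<le> ereal (\<delta> * log_plus (norm z) + C)" using u by (auto simp: Lelong_def)
  show ?thesis
  proof (rule LelongI[where C = "C + m * ln (1 + cmod q)"])
    show "psh (\<lambda>p. u p + ereal m * elog (cmod (p $ i - q)))" using u m by (auto simp: Lelong_def intro: psh_add_log)
    fix p :: "complex^'n"
    have "elog (cmod (p $ i - q)) \<le> ereal (log_plus (norm p) + ln (1 + cmod q))"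
    proof (cases "p $ i = q")
      case False
      have "cmod (p $ i - q) \<le> cmod (p $ i) + cmod q" by (rule norm_triangle_ineq4)
      also have "\<dots> \<le> norm p + cmod q" using Finite_Cartesian_Product.norm_nth_le[of p i] by simp
      also have "\<dots> \<le> max (norm p) 1 * (1 + cmod q)"
      proof -
        have "1 * cmod q \<le> max (norm p) 1 * cmod q" by (intro mult_right_mono) auto
        moreover have "norm p \<le> max (norm p) 1" by simp
        ultimately show ?thesis unfolding distrib_left by linarith
      qed
      finally have "ln (cmod (p $ i - q)) \<le> ln (max (norm p) 1 * (1 + cmod q))"
        using False by (intro ln_mono) auto
      also have "\<dots> = ln (max (norm p) 1) + ln (1 + cmod q)"
        by (rule ln_mult_pos) (auto simp: add_pos_nonneg)
      also have "ln (max (norm p) 1) = log_plus (norm p)" by (auto simp: log_plus_def max_def)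
      finally show ?thesis using False by (simp add: elog_def)
    qed (simp add: elog_def)
    from ereal_mult_left_mono[OF this, of "ereal m"] m
    have "ereal m * elog (cmod (p $ i - q)) \<le> ereal (m * (log_plus (norm p) + ln (1 + cmod q)))" by simp
    from add_mono[OF C[of p] this]
    show "u p + ereal m * elog (cmod (p $ i - q)) \<le> ereal ((\<delta> + m) * log_plus (norm p) + (C + m * ln (1 + cmod q)))"
      by (simp add: algebra_simps)
  qed
qed

lemma Lelong_zero: "\<delta> \<ge> 0 \<Longrightarrow> (\<lambda>_. 0) \<in> Lelong \<delta>"
proof (rule LelongI[where C = 0])
  show "psh (\<lambda>_ :: complex^'n. 0 :: ereal)"
    by (rule psh_local[of _ 0]) (auto simp: usc_def loc_submean_const)
  show "0 \<le> ereal (\<delta> * log_plus (norm z) + 0)" if "\<delta> \<ge> 0" for z using that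
    by (simp add: log_plus_nonneg)
qed

lemma norm_vec1: "norm (z :: complex^1) = cmod (z $ 1)"
  by (simp add: norm_vec_def L2_set_def UNIV_1)

lemma Lelong_pullback:
  fixes g :: "complex^1 \<Rightarrow> ereal"
  assumes g: "g \<in> Lelong \<delta>" and \<delta>: "\<delta> \<ge> 0"
  shows "(\<lambda>p :: complex^'n. g (vec (p $ i))) \<in> Lelong \<delta>"
proof -
  obtain C where C: "\<And>z. g z \<le> ereal (\<delta> * log_plus (norm z) + C)" using g by (auto simp: Lelong_def)
  have psh: "psh g" using g by (auto simp: Lelong_def)
  then obtain z0 where z0: "g z0 \<noteq> -\<infinity>" by (auto simp: psh_def)
  show ?thesis
  proof (rule LelongI[where C = C])
    show "psh (\<lambda>p :: complex^'n. g (vec (p $ i)))"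
    proof (rule psh_local[of _ "vec (z0 $ 1)"])
      show "usc (\<lambda>p :: complex^'n. g (vec (p $ i)))"
        by (rule usc_compose_continuous[OF psh_usc[OF psh]]) (auto simp: vec_def intro!: continuous_intros)
      show "g (vec (p $ i)) < \<infinity>" for p :: "complex^'n" by (rule psh_less_infinity[OF psh])
      have "vec ((vec (z0 $ 1) :: complex^'n) $ i) = z0" by (simp add: vec_eq_iff forall_1)
      then show "g (vec ((vec (z0 $ 1) :: complex^'n) $ i)) \<noteq> -\<infinity>" using z0 by simp
      fix a b :: "complex^'n"
      have "vec ((a + \<zeta> *s b) $ i) = (vec (a $ i) + \<zeta> *s vec (b $ i) :: complex^1)" for \<zeta>
        by (simp add: vec_eq_iff)
      then show "loc_submean (\<lambda>\<zeta>. g (vec ((a + \<zeta> *s b) $ i))) 0"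
        using psh_loc_submean[OF psh, of "vec (a $ i)" "vec (b $ i)"] by simp
    qed
    fix p :: "complex^'n"
    have "norm (vec (p $ i) :: complex^1) \<le> norm p"
      using Finite_Cartesian_Product.norm_nth_le[of p i] by (simp add: norm_vec1)
    then have "\<delta> * log_plus (norm (vec (p $ i) :: complex^1)) \<le> \<delta> * log_plus (norm p)"
      using \<delta> by (intro mult_left_mono log_plus_mono) auto
    then show "g (vec (p $ i)) \<le> ereal (\<delta> * log_plus (norm p) + C)"
      using C[of "vec (p $ i)"] by (meson add_right_mono ereal_less_eq(3) order_trans)
  qed
qed

section \<open>Regularisations and extremal functions\<close>

lemma usc_reg_ge: "f z \<le> usc_reg f z"
  unfolding usc_reg_def Limsup_def
  by (rule INF_greatest) (auto intro!: SUP_upper dest: eventually_nhds_x_imp_x)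

lemma usc_reg_lessD: "usc_reg f z < t \<Longrightarrow> eventually (\<lambda>x. f x < t) (nhds z)"
  unfolding usc_reg_def by (rule Limsup_lessD)

lemma usc_reg_mono: "(\<And>x. f x \<le> g x) \<Longrightarrow> usc_reg f z \<le> usc_reg g z"
  unfolding usc_reg_def by (intro Limsup_mono always_eventually) auto

text \<open>Regularisations are handled by continuous majorants: this lemma and \<open>usc_reg_lessD\<close> replace
  all computations with upper limits.\<close>

lemma usc_reg_le:
  assumes "eventually (\<lambda>x. f x \<le> ereal (g x)) (nhds z)" "isCont g z"
  shows "usc_reg f z \<le> ereal (g z)"
proof -
  have "(g \<longlongrightarrow> g z) (nhds z)"
    using assms(2) by (simp add: isCont_def tendsto_at_iff_tendsto_nhds)
  then have "((\<lambda>x. ereal (g x)) \<longlongrightarrow> ereal (g z)) (nhds z)" by simp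
  then have "Limsup (nhds z) (\<lambda>x. ereal (g x)) = ereal (g z)"
    by (intro lim_imp_Limsup) auto
  then show ?thesis unfolding usc_reg_def using Limsup_mono[OF assms(1)] by simp
qed

lemma extremal_upper: "u \<in> Lelong \<delta> \<Longrightarrow> (\<And>p. p \<in> K \<Longrightarrow> u p \<le> ereal (\<psi> p)) \<Longrightarrow> u z \<le> extremal \<delta> K \<psi> z"
  unfolding extremal_def by (auto intro: SUP_upper)

lemma extremal_least:
  "(\<And>u. u \<in> Lelong \<delta> \<Longrightarrow> (\<And>p. p \<in> K \<Longrightarrow> u p \<le> ereal (\<psi> p)) \<Longrightarrow> u z \<le> t) \<Longrightarrow> extremal \<delta> K \<psi> z \<le> t"
  unfolding extremal_def by (rule SUP_least) auto

lemma extremal_mono_degree: "\<delta> \<le> \<delta>' \<Longrightarrow> extremal \<delta> K \<psi> z \<le> extremal \<delta>' K \<psi> z"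
  by (intro extremal_least extremal_upper) (auto intro: Lelong_mono)

lemma norm_vector_scalar_mult: "norm (c *s x) = cmod c * norm (x :: complex^'n)"
  by (simp add: norm_vec_def norm_mult L2_set_right_distrib)

text \<open>The one-variable inequality on the complex line through \<open>0\<close> and \<open>p\<close>.\<close>

proposition Lelong_Bernstein_Walsh:
  fixes u :: "complex^'n \<Rightarrow> ereal"
  assumes u: "u \<in> Lelong \<delta>" and \<delta>: "\<delta> \<ge> 0" and m: "\<And>p. norm p \<le> 1 \<Longrightarrow> u p \<le> ereal m"
    and p: "norm p \<ge> 1"
  shows "u p \<le> ereal (m + \<delta> * ln (norm p))"
proof -
  obtain C where C: "\<And>z. u z \<le> ereal (\<delta> * log_plus (norm z) + C)" and "psh u" using u by (auto simp: Lelong_def)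
  define e where "e = inverse (of_real (norm p)) *s p"
  have e: "norm e = 1" using p by (auto simp: e_def norm_vector_scalar_mult norm_inverse intro!: left_inverse)
  have "of_real (norm p) * inverse (of_real (norm p)) = (1 :: complex)"
    using p by (intro right_inverse) auto
  then have pe: "p = 0 + of_real (norm p) *s e" by (simp add: e_def vector_smult_assoc)
  have "u (0 + of_real (norm p) *s e) \<le> ereal (m + \<delta> * ln (cmod (of_real (norm p)) / 1))"
  proof (rule Bernstein_Walsh[OF psh_line[OF \<open>psh u\<close>] \<delta>])
    show "u (0 + z *s e) \<le> ereal (\<delta> * log_plus (cmod z) + C)" for z
      using C[of "z *s e"] e by (simp add: norm_vector_scalar_mult)
    show "u (0 + z *s e) \<le> ereal m" if "cmod z \<le> 1" for z
      using m[of "z *s e"] e that by (simp add: norm_vector_scalar_mult)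
  qed (use p in auto)
  then show ?thesis using pe by simp
qed

section \<open>The function \<open>V\<^sub>H\<close> and the two-sided comparison\<close>

lemma norm_complex2: "(norm (p :: complex^2))\<^sup>2 = (cmod (p $ 1))\<^sup>2 + (cmod (p $ 2))\<^sup>2"
  by (simp add: norm_vec_def L2_set_def sum_2)

lemma set_A_eq: "set_A = {p. norm p \<le> 1}"
  unfolding set_A_def norm_complex2[symmetric] by (auto simp: power_le_one_iff abs_square_le_1)

text \<open>This crude bound keeps every interval \<open>I\<^sub>j\<close> inside \<open>[2, 3]\<close> and within \<open>2 / 2\<^sup>j\<close> of \<open>3\<close>; the
  true size of \<open>r\<^sub>j\<close> enters in \<open>log_sum_le_on_I\<close>.\<close>

lemma r_seq_le: "r_seq j \<le> 1 / 2 ^ j"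
proof -
  have "(2::real) ^ j \<le> 1 + 16 * 2 ^ j" by simp
  also have "\<dots> \<le> exp (16 * 2 ^ j)" by (rule exp_ge_add_one_self)
  finally show ?thesis by (simp add: r_seq_def exp_minus field_simps)
qed

lemma r_seq_pos: "r_seq j > 0" by (simp add: r_seq_def)

lemma set_I_cases:
  assumes "x \<in> set_I"
  obtains "x = 3" | j t where "j \<ge> 1" "x = complex_of_real t" "\<bar>t - q_seq j\<bar> \<le> r_seq j"
  using assms by (fastforce simp: set_I_def abs_le_iff)

lemma set_I_real:
  assumes "x \<in> set_I"
  obtains t where "x = complex_of_real t" "2 \<le> t" "t \<le> 3"
  using assms
proof (cases rule: set_I_cases)
  case (2 j t)
  have "(2::real) ^ 1 \<le> 2 ^ j" using 2 by (intro power_increasing) auto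
  then have "1 / (2::real) ^ j \<le> 1 / 2" by (simp add: field_simps)
  then have "2 \<le> t" "t \<le> 3" using 2(3) r_seq_le[of j] unfolding q_seq_def by linarith+
  then show ?thesis using 2(2) that by blast
qed (use that[of 3] in auto)

abbreviation V_H :: "complex^1 \<Rightarrow> ereal" where
  "V_H \<equiv> extremal 1 {z :: complex^1. z $ 1 \<in> set_H} (\<lambda>_. 0)"

lemma vec_index_1 [simp]: "vec (x $ 1) = (x :: 'a^1)"
  by (simp add: vec_eq_iff forall_1)

lemma V_H_competitor_le_log:
  assumes g: "g \<in> Lelong 1" "\<And>z :: complex^1. z $ 1 \<in> set_H \<Longrightarrow> g z \<le> ereal 0" and x: "cmod x \<ge> 1"
  shows "g (vec x) \<le> ereal (ln (cmod x))"
proof -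
  have "g (vec x) \<le> ereal (0 + 1 * ln (norm (vec x :: complex^1)))"
  proof (rule Lelong_Bernstein_Walsh[OF g(1)])
    fix p :: "complex^1"
    assume "norm p \<le> 1"
    then have "p $ 1 \<in> set_H" by (simp add: norm_vec1 set_H_def)
    then show "g p \<le> ereal 0" by (rule g(2))
  qed (use x in \<open>auto simp: norm_vec1\<close>)
  then show ?thesis by (simp add: norm_vec1)
qed

lemma V_H_nonneg: "V_H x \<ge> 0"
  using extremal_upper[of "\<lambda>_. 0" 1 "{z :: complex^1. z $ 1 \<in> set_H}" "\<lambda>_. 0" x] Lelong_zero[of 1] by simp

lemma V_H_le_log: "cmod x \<ge> 1 \<Longrightarrow> V_H (vec x) \<le> ereal (ln (cmod x))"
  by (rule extremal_least, rule V_H_competitor_le_log) auto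

lemma continuous_nearby_affine:
  fixes c d :: complex
  assumes "cmod c * s > 1" "s > 0"
  obtains R where "R > 0" "\<And>\<zeta>. \<zeta> \<in> ball 0 R \<Longrightarrow> cmod (c + \<zeta> * d) * s > 1"
proof -
  have "open ((\<lambda>\<zeta>. cmod (c + \<zeta> * d) * s) -` {1<..})"
    by (intro open_vimage continuous_intros)
  moreover have "0 \<in> (\<lambda>\<zeta>. cmod (c + \<zeta> * d) * s) -` {1<..}" using assms by simp
  ultimately obtain R where "R > 0" "ball 0 R \<subseteq> (\<lambda>\<zeta>. cmod (c + \<zeta> * d) * s) -` {1<..}"
    using openE by blast
  then show ?thesis using that by blast
qed

text \<open>Let \<open>p = w e\<close> with \<open>e\<close> of second coordinate \<open>1\<close>, and let \<open>s = norm e\<close>. On the line through \<open>e\<close>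
  the weight outside the unit ball is exactly \<open>\<tau> (b + ln s + ln |\<zeta>|)\<close>, a harmonic function, so
  \<open>v = u - \<tau> (b + ln s + ln |\<zeta>|)\<close> is subharmonic there. It is nonpositive on the circle
  \<open>|\<zeta>| = 1 / s\<close>, which bounds a disc in \<open>A\<close>, and on \<open>I\<close>, because the corresponding points lie
  in \<open>B\<close>. Hence \<open>max 0 v\<close>, extended by \<open>0\<close> into the disc, is subharmonic on the whole plane and of
  logarithmic growth \<open>h\<close>: the growth \<open>\<tau>\<close> has been used up by the weight. Up to the factor \<open>h\<close> and
  the small correction \<open>ln s\<close>, which accounts for the radius \<open>1 / s\<close> being at most \<open>1\<close>, it competes for \<open>V\<^sub>H\<close>.
  Lines through the origin, rather than parallels to the \<open>w\<close>-axis, are what makes the weight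
  harmonic along the line.\<close>

proposition competitor_bound_near_axis:
  fixes \<Phi> :: "complex^2 \<Rightarrow> real" and p :: "complex^2"
  assumes in_ball: "\<And>z. norm z \<le> 1 \<Longrightarrow> \<Phi> z \<le> b"
    and outside: "\<And>z. norm z \<ge> 1 \<Longrightarrow> \<Phi> z = ln (norm z) + b"
    and \<tau>: "\<tau> > 0" and h: "h > 0"
    and u: "u \<in> Lelong (\<tau> + h)" "\<And>p. p \<in> set_K \<Longrightarrow> u p \<le> ereal (\<tau> * \<Phi> p)"
    and p: "cmod (p $ 2) > 1" "cmod (p $ 1) \<le> cmod (p $ 2) / 3"
  shows "u p \<le> ereal (\<tau> * (ln (norm p) + b) + h * ln (norm p / cmod (p $ 2))) + ereal h * V_H (vec (p $ 2))"
proof -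
  have pu: "psh u" using u by (simp add: Lelong_def)
  define w where "w = p $ 2"
  define e :: "complex^2" where "e = vector [p $ 1 / w, 1]"
  define s where "s = norm e"
  have w: "cmod w > 1" "w \<noteq> 0" using p(1) by (auto simp: w_def)
  have e2: "e $ 2 = 1" "e $ 1 = p $ 1 / w" by (auto simp: e_def)
  have "s \<ge> cmod (e $ 2)" unfolding s_def by (rule Finite_Cartesian_Product.norm_nth_le)
  then have s1: "s \<ge> 1" by (simp add: e2)
  have pe: "p = w *s e" using w by (simp add: vec_eq_iff forall_2 e2 w_def)
  have normp: "norm p = cmod w * s" by (subst pe) (simp add: norm_vector_scalar_mult s_def)
  have e1: "cmod (e $ 1) \<le> 1/3" using p(2) w by (simp add: e2 norm_divide w_def[symmetric] field_simps)
  have bw: "u (\<zeta> *s e) \<le> ereal (\<tau> * b + (\<tau> + h) * ln (cmod \<zeta> * s))" if "cmod \<zeta> * s \<ge> 1" for \<zeta>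
  proof -
    have "u (\<zeta> *s e) \<le> ereal (\<tau> * b + (\<tau> + h) * ln (norm (\<zeta> *s e)))"
    proof (rule Lelong_Bernstein_Walsh[OF u(1)])
      fix q :: "complex^2"
      assume q: "norm q \<le> 1"
      then have "u q \<le> ereal (\<tau> * \<Phi> q)" by (intro u(2)) (auto simp: set_K_def set_A_eq)
      also have "\<dots> \<le> ereal (\<tau> * b)" using in_ball[OF q] \<tau> by simp
      finally show "u q \<le> ereal (\<tau> * b)" .
    qed (use \<tau> h that in \<open>auto simp: norm_vector_scalar_mult s_def\<close>)
    then show ?thesis by (simp add: norm_vector_scalar_mult s_def)
  qed
  define v where "v \<zeta> = u (\<zeta> *s e) + ereal (- \<tau> * b - \<tau> * ln s - \<tau> * ln (cmod \<zeta>))" for \<zeta>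
  define W where "W x = (if cmod (x $ 1) * s \<le> 1 then 0 else max 0 (v (x $ 1)))" for x :: "complex^1"
  have v_le: "v \<zeta> \<le> ereal (h * (ln (cmod \<zeta>) + ln s))" if "cmod \<zeta> * s \<ge> 1" for \<zeta>
  proof -
    have "\<zeta> \<noteq> 0" using that by auto
    then have ln: "ln (cmod \<zeta> * s) = ln (cmod \<zeta>) + ln s" using s1 by (intro ln_mult_pos) auto
    show ?thesis unfolding v_def
      using add_right_mono[OF bw[OF that], of "ereal (- \<tau> * b - \<tau> * ln s - \<tau> * ln (cmod \<zeta>))"] unfolding ln
      by (simp add: algebra_simps)
  qed
  have W_nonneg: "W x \<ge> 0" for x by (simp add: W_def)
  have W_le: "W x \<le> ereal (h * log_plus (norm x) + h * ln s)" for x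
  proof (cases "cmod (x $ 1) * s \<le> 1")
    case True
    then show ?thesis using h s1 by (simp add: W_def log_plus_nonneg)
  next
    case False
    then have "x $ 1 \<noteq> 0" by auto
    then have "ln (cmod (x $ 1)) \<le> log_plus (norm x)" by (simp add: log_plus_def norm_vec1)
    then have "h * (ln (cmod (x $ 1)) + ln s) \<le> h * log_plus (norm x) + h * ln s"
      using h by (simp add: distrib_left)
    moreover have "0 \<le> h * log_plus (norm x) + h * ln s" using h s1 by (simp add: log_plus_nonneg)
    moreover have "v (x $ 1) \<le> ereal (h * (ln (cmod (x $ 1)) + ln s))" by (rule v_le) (use False in auto)
    ultimately have "v (x $ 1) \<le> ereal (h * log_plus (norm x) + h * ln s)"
      by (meson ereal_less_eq(3) order_trans)
    then show ?thesis using False \<open>0 \<le> h * log_plus (norm x) + h * ln s\<close> unfolding W_def by (simp add: zero_ereal_def)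
  qed
  have W_fin: "W x < \<infinity>" for x using W_le[of x] by (cases "W x") auto
  have "psh W"
  proof (rule psh_local[of _ 0])
    show "W 0 \<noteq> -\<infinity>" by (simp add: W_def)
    \<comment> \<open>the two formulas for \<open>W\<close> overlap on \<open>|\<zeta>| s = 1\<close>, where \<open>v \<le> 0\<close>; so strict sublevel sets are unions of two open sets\<close>
    show "usc W" unfolding usc_def
    proof
      fix t
      show "open {x. W x < t}"
      proof (cases "t \<le> 0")
        case True
        then have "\<not> W x < t" for x using W_nonneg[of x] by (meson not_less order_trans)
        then have "{x. W x < t} = {}" by blast
        then show ?thesis by simp
      next
        case False
        define O1 where "O1 = {x :: complex^1. cmod (x $ 1) * s < 1}"
        define k where "k x = - \<tau> * b - \<tau> * ln s - \<tau> * ln (cmod (x $ 1))" for x :: "complex^1"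
        define O2 where "O2 = {x :: complex^1. x $ 1 \<noteq> 0 \<and> u (x $ 1 *s e) + ereal (k x) < t}"
        have "open O1" unfolding O1_def by (intro open_Collect_less continuous_intros)
        moreover have "open O2"
        proof (subst open_subopen, rule ballI)
          fix x assume "x \<in> O2"
          then have x: "x \<in> {x. x $ 1 \<noteq> 0}" "u (x $ 1 *s e) + ereal (k x) < t" by (simp_all add: O2_def)
          have us: "usc (\<lambda>x :: complex^1. u (x $ 1 *s e))"
            by (rule usc_compose_continuous[OF psh_usc[OF pu]]) (intro continuous_intros)
          have k: "continuous_on {x. x $ 1 \<noteq> 0} k" unfolding k_def by (intro continuous_intros) simp_all
          obtain N where N: "open N" "x \<in> N" "\<And>z. z \<in> N \<Longrightarrow> z \<in> {x. x $ 1 \<noteq> 0} \<Longrightarrow> u (z $ 1 *s e) + ereal (k z) < t"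
            by (rule usc_plus_continuous_nbhd[OF us k x]) blast
          have "open {x :: complex^1. x $ 1 \<noteq> 0}"
            by (intro open_Collect_neq continuous_intros)
          then have "open (N \<inter> {x. x $ 1 \<noteq> 0})" using N(1) by (rule open_Int[rotated])
          moreover have "N \<inter> {x. x $ 1 \<noteq> 0} \<subseteq> O2"
          proof
            fix z assume "z \<in> N \<inter> {x. x $ 1 \<noteq> 0}"
            then show "z \<in> O2" using N(3)[of z] by (simp add: O2_def)
          qed
          ultimately show "\<exists>T. open T \<and> x \<in> T \<and> T \<subseteq> O2" using N(2) x(1) by blast
        qed
        moreover have "W x < t \<longleftrightarrow> x \<in> O1 \<or> x \<in> O2" for x
        proof -
          have t0: "0 < t" using False by simp
          have O2: "x \<in> O2 \<longleftrightarrow> x $ 1 \<noteq> 0 \<and> v (x $ 1) < t" by (simp add: O2_def k_def v_def)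
          consider "cmod (x $ 1) * s < 1" | "cmod (x $ 1) * s = 1" | "cmod (x $ 1) * s > 1" by linarith
          then show ?thesis
          proof cases
            case 1
            then show ?thesis using t0 by (simp add: W_def O1_def)
          next
            case 2
            then have x0: "x $ 1 \<noteq> 0" by auto
            have "ln (cmod (x $ 1) * s) = ln (cmod (x $ 1)) + ln s" using s1 x0 by (intro ln_mult_pos) auto
            then have "v (x $ 1) \<le> 0" using v_le[of "x $ 1"] 2 by (simp add: zero_ereal_def)
            then have "v (x $ 1) < t" using t0 by (rule le_less_trans)
            then show ?thesis using t0 x0 2 unfolding O2 by (simp add: W_def)
          next
            case 3
            then have x0: "x $ 1 \<noteq> 0" by auto
            have "W x = max 0 (v (x $ 1))" using 3 by (simp add: W_def)
            then show ?thesis using t0 x0 3 unfolding O2 by (simp add: O1_def)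
          qed
        qed
        then have "{x. W x < t} = O1 \<union> O2" by blast
        ultimately show ?thesis by (simp add: open_Un)
      qed
    qed
    show "loc_submean (\<lambda>\<zeta>. W (a + \<zeta> *s d)) 0" for a d
    proof (cases "W a = 0")
      case True
      show ?thesis by (rule loc_submean_minorant[OF loc_submean_const[of 0] zero_less_one]) (use True W_nonneg in auto)
    next
      case False
      define c where "c = a $ 1"
      have c: "cmod c * s > 1" "W a = v c" using False by (auto simp: W_def c_def max_def split: if_splits)
      then have "c \<noteq> 0" by auto
      obtain R where R: "R > 0" "\<And>\<zeta>. \<zeta> \<in> ball 0 R \<Longrightarrow> cmod (c + \<zeta> * d $ 1) * s > 1"
        using continuous_nearby_affine[OF c(1)] s1 by (metis less_le_trans zero_less_one)
      have har: "loc_harmonic (\<lambda>\<zeta>. (- \<tau> * b - \<tau> * ln s) + - \<tau> * ln (cmod (c + \<zeta> * d $ 1))) 0"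
        by (intro loc_harmonic_add loc_harmonic_const loc_harmonic_cmult loc_harmonic_ln_affine) (use \<open>c \<noteq> 0\<close> in auto)
      have "loc_submean (\<lambda>\<zeta>. u (c *s e + \<zeta> *s (d $ 1 *s e)) + ereal ((- \<tau> * b - \<tau> * ln s) + - \<tau> * ln (cmod (c + \<zeta> * d $ 1)))) 0"
        by (rule loc_submean_add_harmonic[OF psh_loc_submean[OF pu] har])
      then have v: "loc_submean (\<lambda>\<zeta>. v (c + \<zeta> * d $ 1)) 0"
        by (simp add: v_def vector_sadd_rdistrib vector_smult_assoc)
      show ?thesis
      proof (rule loc_submean_minorant[OF v R(1)])
        show "W (a + 0 *s d) \<le> v (c + 0 * d $ 1)" using c by simp
        show "v (c + z * d $ 1) \<le> W (a + z *s d)" if "z \<in> ball 0 R" for z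
          using R(2)[OF that] by (simp add: W_def c_def)
      qed
    qed
  qed (rule W_fin)
  then have "W \<in> Lelong h" by (rule LelongI) (rule W_le)
  then have L: "(\<lambda>x. ereal (1/h) * W x + ereal (- ln s)) \<in> Lelong 1"
    using Lelong_add_const[OF Lelong_cmult[of W h "1/h"]] h by simp
  have "ereal (1/h) * W (vec w) + ereal (- ln s) \<le> V_H (vec w)"
  proof (rule extremal_upper[OF L])
    fix x :: "complex^1"
    assume "x \<in> {z. z $ 1 \<in> set_H}"
    then have "cmod (x $ 1) \<le> 1 \<or> x $ 1 \<in> set_I" by (auto simp: set_H_def)
    then have "W x \<le> ereal (h * ln s)"
    proof
      assume "cmod (x $ 1) \<le> 1"
      then have "log_plus (norm x) = 0" by (auto simp: log_plus_def norm_vec1 max_def)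
      then show ?thesis using W_le[of x] by simp
    next
      assume I: "x $ 1 \<in> set_I"
      then obtain t where t: "x $ 1 = of_real t" "2 \<le> t" "t \<le> 3" by (rule set_I_real)
      have "x $ 1 *s e \<in> set_B"
      proof -
        have "cmod (x $ 1 * e $ 1) \<le> 3 * (1/3)"
          unfolding norm_mult using t e1 by (intro mult_mono) auto
        then show ?thesis using I by (simp add: set_B_def e2(1))
      qed
      then have "u (x $ 1 *s e) \<le> ereal (\<tau> * \<Phi> (x $ 1 *s e))" by (intro u(2)) (simp add: set_K_def)
      also have "\<Phi> (x $ 1 *s e) = ln (cmod (x $ 1) * s) + b"
      proof (subst outside)
        have "2 * 1 \<le> t * s" using t s1 by (intro mult_mono) auto
        then show "1 \<le> norm (x $ 1 *s e)" using t by (simp add: norm_vector_scalar_mult s_def)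
      qed (simp add: norm_vector_scalar_mult s_def)
      also have "ln (cmod (x $ 1) * s) = ln (cmod (x $ 1)) + ln s" using s1 t by (intro ln_mult_pos) auto
      finally have "v (x $ 1) \<le> 0"
        unfolding v_def by (cases "u (x $ 1 *s e)") (auto simp: algebra_simps)
      then have "W x = 0" by (auto simp: W_def max_def)
      then show ?thesis using h s1 by simp
    qed
    from ereal_mult_left_mono[OF this, of "ereal (1/h)"] h
    have "ereal (1/h) * W x \<le> ereal (ln s)" by simp
    from add_right_mono[OF this, of "ereal (- ln s)"]
    show "ereal (1/h) * W x + ereal (- ln s) \<le> ereal 0" by simp
  qed
  moreover have "v w \<le> W (vec w)"
  proof -
    have "1 * 1 < cmod w * s" using w s1 by (intro mult_less_le_imp_less) auto
    then show ?thesis by (simp add: W_def)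
  qed
  then have "ereal (1/h) * v w + ereal (- ln s) \<le> ereal (1/h) * W (vec w) + ereal (- ln s)"
    using h by (intro add_right_mono ereal_mult_left_mono) auto
  ultimately have main: "ereal (1/h) * v w + ereal (- ln s) \<le> V_H (vec w)" by (rule order_trans[rotated])
  obtain VV where VV: "V_H (vec w) = ereal VV"
    using V_H_nonneg[of "vec w"] V_H_le_log[of w] w by (cases "V_H (vec w)") auto
  have lnp: "ln (norm p) = ln (cmod w) + ln s" unfolding normp using w s1 by (intro ln_mult_pos) auto
  have lns: "norm p / cmod w = s" using w normp by simp
  show ?thesis
  proof (cases "u p")
    case (real r)
    have "(r - \<tau> * b - \<tau> * ln s - \<tau> * ln (cmod w)) / h - ln s \<le> VV"
      using main real by (simp add: VV v_def pe[symmetric] diff_diff_eq[symmetric] algebra_simps(1-4) diff_divide_distrib add_divide_distrib)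
    then have "(r - \<tau> * b - \<tau> * ln s - \<tau> * ln (cmod w)) \<le> (VV + ln s) * h"
      using h by (simp add: field_simps)
    then show ?thesis using real VV unfolding w_def[symmetric] lns lnp
      by (simp add: algebra_simps)
  next
    case PInf
    then show ?thesis using psh_less_infinity[OF pu, of p] by simp
  qed simp
qed

text \<open>For a competitor \<open>g\<close> of \<open>V\<^sub>H\<close> the function \<open>\<tau> (b + ln |w|) + h g(w)\<close> competes for the weighted
  problem. On \<open>A\<close> and on the cylinder over \<open>I\<close> this holds because \<open>g \<le> 0\<close> on \<open>H\<close> and
  \<open>b + ln |w| \<le> \<Phi>\<close>. On \<open>\<Gamma>\<close>, where \<open>g\<close> may be as large as \<open>ln 5\<close>, there is room because
  \<open>|z| = 1\<close> and \<open>3 \<le> w \<le> 5\<close>: the weight exceeds \<open>\<tau> (b + ln |w|)\<close> by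
  \<open>(\<tau>/2) ln (1 + 1/|w|\<^sup>2) \<ge> (\<tau>/2) ln (26/25)\<close>. This is where \<open>kappa \<tau>\<close> comes from.\<close>

proposition V_H_bound_from_extremal:
  fixes \<Phi> :: "complex^2 \<Rightarrow> real"
  assumes outside: "\<And>z. norm z \<ge> 1 \<Longrightarrow> \<Phi> z = ln (norm z) + b"
    and ge: "\<And>z. z \<noteq> 0 \<Longrightarrow> \<Phi> z \<ge> b + ln (norm z)"
    and \<tau>: "\<tau> > 0" and h: "0 < h" "h \<le> kappa \<tau>"
    and x: "x \<noteq> 0" and T: "extremal (\<tau> + h) set_K (\<lambda>p. \<tau> * \<Phi> p) (vector [0, x]) \<le> ereal T"
  shows "V_H (vec x) \<le> ereal ((T - \<tau> * (b + ln (cmod x))) / h)"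
proof (rule extremal_least)
  fix g :: "complex^1 \<Rightarrow> ereal"
  assume g: "g \<in> Lelong 1" "\<And>p. p \<in> {z. z $ 1 \<in> set_H} \<Longrightarrow> g p \<le> ereal 0"
  define u where "u p = ereal h * g (vec (p $ 2)) + ereal \<tau> * elog (cmod (p $ 2 - 0)) + ereal (\<tau> * b)" for p :: "complex^2"
  have "(\<lambda>p :: complex^2. ereal h * g (vec (p $ 2))) \<in> Lelong (h * 1)"
    by (intro Lelong_cmult Lelong_pullback g h) auto
  from Lelong_add_const[OF Lelong_add_log[OF this \<tau>, of 2 0], of "\<tau> * b"]
  have "u \<in> Lelong (\<tau> + h)" unfolding u_def by (simp add: add.commute)
  moreover have "u p \<le> ereal (\<tau> * \<Phi> p)" if p: "p \<in> set_K" for p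
  proof (cases "p $ 2 = 0")
    case True
    have "g (vec 0) \<le> ereal 0" by (intro g) (auto simp: set_H_def)
    then have "u p = -\<infinity>" using True \<tau> h by (cases "g (vec 0)") (auto simp: u_def elog_def)
    then show ?thesis by simp
  next
    case False
    then have p0: "p \<noteq> 0" by auto
    let ?t = "cmod (p $ 2)"
    have u: "u p = ereal h * g (vec (p $ 2)) + ereal (\<tau> * (b + ln ?t))"
      using False by (cases "g (vec (p $ 2))") (auto simp: u_def elog_def algebra_simps)
    have np: "?t \<le> norm p" by (rule Finite_Cartesian_Product.norm_nth_le)
    have key: ?thesis if gh: "g (vec (p $ 2)) \<le> ereal 0"
    proof -
      have "ereal h * g (vec (p $ 2)) \<le> ereal h * ereal 0" using h gh by (intro ereal_mult_left_mono) auto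
      then have "u p \<le> ereal 0 + ereal (\<tau> * (b + ln ?t))" unfolding u by (intro add_right_mono) simp
      also have "\<dots> \<le> ereal (\<tau> * \<Phi> p)"
      proof -
        have "ln ?t \<le> ln (norm p)" using np False by (intro ln_mono) auto
        then show ?thesis using ge[OF p0] \<tau> by simp
      qed
      finally show ?thesis .
    qed
    consider "p \<in> set_A" | "p $ 2 \<in> set_I" | "p \<in> set_Gamma" using p by (auto simp: set_K_def set_B_def)
    then show ?thesis
    proof cases
      case 1
      then have "?t \<le> 1" using np by (simp add: set_A_eq)
      then show ?thesis by (intro key g) (simp add: set_H_def)
    next
      case 2
      then show ?thesis by (intro key g) (simp add: set_H_def)
    next
      case 3
      then obtain \<theta> t where t: "p = vector [cis \<theta>, complex_of_real t]" "3 \<le> t" "t \<le> 4 - cos \<theta>"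
        by (auto simp: set_Gamma_def)
      have t5: "t \<le> 5" using t(3) cos_ge_minus_one[of \<theta>] by linarith
      have tt: "?t = t" using t by simp
      have n2: "(norm p)\<^sup>2 = 1 + t\<^sup>2" using t by (simp add: norm_complex2)
      have "g (vec (p $ 2)) \<le> ereal (ln ?t)"
        by (rule V_H_competitor_le_log[OF g(1)]) (use g(2) tt t in auto)
      also have "\<dots> \<le> ereal (ln 5)" using t t5 tt by simp
      finally have "ereal h * g (vec (p $ 2)) \<le> ereal h * ereal (ln 5)" using h by (intro ereal_mult_left_mono) auto
      then have "u p \<le> ereal (h * ln 5) + ereal (\<tau> * (b + ln t))" unfolding u tt by (intro add_right_mono) simp
      also have "\<dots> \<le> ereal (\<tau> * \<Phi> p)"
      proof -
        have "h * ln 5 \<le> kappa \<tau> * ln 5" using h by (intro mult_right_mono) auto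
        also have "\<dots> = \<tau> * (ln (26/25) / 2)" by (simp add: kappa_def)
        also have "\<dots> \<le> \<tau> * (ln (norm p) - ln t)"
        proof (intro mult_left_mono)
          have "t\<^sup>2 \<le> 5\<^sup>2" using t t5 by (intro power_mono) auto
          then have "(26/25) * t\<^sup>2 \<le> 1 + t\<^sup>2" by simp
          then have "ln ((26/25) * t\<^sup>2) \<le> ln ((norm p)\<^sup>2)" unfolding n2 using t by (intro ln_mono) auto
          moreover have "ln ((26/25) * t\<^sup>2) = ln (26/25) + 2 * ln t"
            using t by (subst ln_mult_pos) (auto simp: ln_realpow)
          moreover have "ln ((norm p)\<^sup>2) = 2 * ln (norm p)" using p0 by (simp add: ln_realpow)
          ultimately show "ln (26/25) / 2 \<le> ln (norm p) - ln t" by simp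
        qed (use \<tau> in simp)
        finally have "h * ln 5 + \<tau> * (b + ln t) \<le> \<tau> * (ln (norm p) + b)" by (simp add: algebra_simps)
        moreover have "norm p \<ge> 1" using np tt t by simp
        ultimately show ?thesis using outside by simp
      qed
      finally show ?thesis .
    qed
  qed
  ultimately have "u (vector [0, x]) \<le> extremal (\<tau> + h) set_K (\<lambda>p. \<tau> * \<Phi> p) (vector [0, x])"
    by (rule extremal_upper)
  then have "u (vector [0, x]) \<le> ereal T" using T by (rule order_trans)
  then have *: "ereal h * g (vec x) + ereal \<tau> * ereal (ln (cmod x)) + ereal (\<tau> * b) \<le> ereal T"
    using x by (simp add: u_def elog_def)
  show "g (vec x) \<le> ereal ((T - \<tau> * (b + ln (cmod x))) / h)"
  proof (cases "g (vec x)")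
    case (real r)
    then show ?thesis using * h by (simp add: field_simps)
  qed (use * h in auto)
qed

section \<open>The value of the regularisation of \<open>V\<^sub>H\<close> at \<open>3\<close>\<close>

text \<open>The partial sums of \<open>ln |z| + \<Sum>\<^sub>j 2\<^sup>-\<^sup>j / 8 \<cdot> ln (|z - q\<^sub>j| / 4)\<close>. The weights are summable, even
  against \<open>j = - ln (3 - q\<^sub>j) / ln 2\<close>, so that the values to the right of \<open>3\<close> stay bounded below;
  still, \<open>2\<^sup>-\<^sup>j / 8 \<cdot> ln r\<^sub>j = -2 < - ln 3\<close>, so that the sum is negative on each \<open>I\<^sub>j\<close>. The
  division by \<open>4\<close> makes every term of the series nonpositive on \<open>H\<close>.\<close>

primrec log_sum :: "nat \<Rightarrow> complex^1 \<Rightarrow> ereal" where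
  "log_sum 0 = (\<lambda>z. 0 + ereal 1 * elog (cmod (z $ 1 - 0)))"
| "log_sum (Suc n) = (\<lambda>z. log_sum n z
      + ereal (1 / (8 * 2 ^ Suc n)) * elog (cmod (z $ 1 - of_real (q_seq (Suc n))))
      + ereal (- (1 / (8 * 2 ^ Suc n)) * ln 4))"

lemma log_sum_Lelong: "log_sum n \<in> Lelong (9/8 - 1 / (8 * 2 ^ n))"
proof (induction n)
  case 0
  show ?case using Lelong_add_log[OF Lelong_zero[of 0], of 1 1 0] by simp
next
  case (Suc n)
  have "9/8 - 1 / (8 * 2 ^ n) + 1 / (8 * 2 ^ Suc n) = 9/8 - 1 / (8 * 2 ^ Suc n :: real)"
    by (simp add: field_simps)
  then show ?case
    using Lelong_add_const[OF Lelong_add_log[OF Suc, of "1 / (8 * 2 ^ Suc n)" 1 "of_real (q_seq (Suc n))"],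
        of "- (1 / (8 * 2 ^ Suc n)) * ln 4"] by simp
qed

lemma elog_le_ln: "t > 0 \<Longrightarrow> x \<le> t \<Longrightarrow> elog x \<le> ereal (ln t)"
  by (simp add: elog_def)

lemma add_log_term_le:
  assumes "c > 0" "x \<le> t" "t > 0" "y \<le> ereal a"
  shows "y + ereal c * elog x + ereal (- c * ln 4) \<le> ereal (a + c * (ln t - ln 4))"
proof -
  have "ereal c * elog x \<le> ereal c * ereal (ln t)"
    using assms by (intro ereal_mult_left_mono elog_le_ln) auto
  from add_mono[OF add_mono[OF assms(4) this] order_refl[of "ereal (- c * ln 4)"]]
  show ?thesis by (simp add: algebra_simps)
qed

lemma log_sum_decreasing:
  fixes z :: "complex^1"
  assumes "cmod (z $ 1 - of_real (q_seq (Suc n))) \<le> 4" "log_sum n z \<le> ereal a"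
  shows "log_sum (Suc n) z \<le> ereal a"
  using add_log_term_le[OF _ assms(1) _ assms(2), of "1 / (8 * 2 ^ Suc n)"] by simp

lemma q_seq_bounds: "2 \<le> q_seq j" "q_seq j \<le> 3"
  by (auto simp: q_seq_def field_simps)

lemma log_sum_le_on_disc:
  fixes z :: "complex^1"
  assumes "cmod (z $ 1) \<le> 1" shows "log_sum n z \<le> ereal 0"
proof (induction n)
  case 0
  show ?case using elog_le_ln[of 1 "cmod (z $ 1)"] assms by simp
next
  case (Suc n)
  have "cmod (z $ 1 - of_real (q_seq (Suc n))) \<le> cmod (z $ 1) + cmod (of_real (q_seq (Suc n)))"
    by (rule norm_triangle_ineq4)
  also have "\<dots> \<le> 4" using assms q_seq_bounds[of "Suc n"] by simp
  finally show ?case by (intro log_sum_decreasing Suc)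
qed

lemma log_sum_le_on_I:
  fixes z :: "complex^1"
  assumes "z $ 1 = of_real t" "2 \<le> t" "t \<le> 3"
  shows "log_sum n z \<le> ereal (ln 3)"
    and "1 \<le> j \<Longrightarrow> \<bar>t - q_seq j\<bar> \<le> r_seq j \<Longrightarrow> log_sum (j + n) z \<le> ereal (ln 3 - 2)"
proof -
  have d: "cmod (z $ 1 - of_real (q_seq k)) = \<bar>t - q_seq k\<bar>" for k
    by (simp only: assms(1) of_real_diff[symmetric] norm_of_real)
  have d4: "\<bar>t - q_seq k\<bar> \<le> 4" for k using assms q_seq_bounds[of k] by simp
  show 1: "log_sum n z \<le> ereal (ln 3)" for n
  proof (induction n)
    case 0
    show ?case using elog_le_ln[of 3 "cmod (z $ 1)"] assms by simp
  next
    case (Suc n)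
    show ?case by (intro log_sum_decreasing Suc) (simp only: d d4)
  qed
  assume j: "1 \<le> j" "\<bar>t - q_seq j\<bar> \<le> r_seq j"
  show "log_sum (j + n) z \<le> ereal (ln 3 - 2)"
  proof (induction n)
    case 0
    obtain k where k: "j = Suc k" using j by (cases j) auto
    have "log_sum (Suc k) z \<le> ereal (ln 3 + (1 / (8 * 2 ^ Suc k)) * (ln (r_seq (Suc k)) - ln 4))"
      unfolding log_sum.simps
      by (rule add_log_term_le) (use j k 1[of k] r_seq_pos[of j] in \<open>simp_all only: d, simp_all\<close>)
    also have "\<dots> \<le> ereal (ln 3 - 2)"
    proof -
      have "(1 / (8 * 2 ^ Suc k)) * (ln (r_seq (Suc k)) - ln 4) = -2 - ln 4 / (8 * 2 ^ Suc k)"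
        by (simp add: r_seq_def field_simps)
      then show ?thesis by simp
    qed
    finally show ?case using k by simp
  next
    case (Suc n)
    show ?case unfolding add_Suc_right by (intro log_sum_decreasing Suc) (simp only: d d4)
  qed
qed

text \<open>The constant is the partial sum \<open>\<Sum>\<^sub>j\<^sub>\<le>\<^sub>n (j + 2) / 2\<^sup>j = 4 - (n + 4) / 2\<^sup>n\<close>, from
  \<open>|3 + t - q\<^sub>j| / 4 \<ge> 2\<^sup>-\<^sup>j / 4\<close>.\<close>

lemma log_sum_ge_right_of_3:
  assumes "t > 0"
  shows "log_sum n (vec (of_real (3 + t))) \<ge> ereal (ln 3 - ln 2 / 8 * (4 - (real n + 4) / 2 ^ n))"
proof (induction n)
  case 0
  have "cmod (3 + complex_of_real t) = 3 + t"
    using assms by (metis abs_of_pos add_pos_pos norm_of_real of_real_add of_real_numeral zero_less_numeral)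
  moreover from this have "3 + complex_of_real t \<noteq> 0"
    using assms by (metis add_pos_pos less_irrefl norm_zero zero_less_numeral)
  moreover have "ln 3 \<le> ln (3 + t)" using assms by (intro ln_mono) auto
  ultimately show ?case by (simp add: elog_def)
next
  case (Suc n)
  define c :: real where "c = 1 / (8 * 2 ^ Suc n)"
  have d: "cmod (of_real (3 + t) - of_real (q_seq (Suc n))) = t + 1 / 2 ^ Suc n"
    using assms by (simp only: of_real_diff[symmetric] norm_of_real) (simp add: q_seq_def)
  have "ln (1 / 2 ^ Suc n) \<le> ln (t + 1 / 2 ^ Suc n)" using assms by (intro ln_mono) auto
  moreover have "ln (1 / 2 ^ Suc n) = - (real (Suc n) * ln 2)" by (simp only: ln_div ln_realpow) (simp add: ln_div ln_realpow)
  ultimately have "- (real (Suc n) * ln 2) \<le> ln (t + 1 / 2 ^ Suc n)" by linarith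
  moreover have "t + 1 / 2 ^ Suc n > 0" using assms by (intro add_pos_pos) auto
  ultimately have "ereal (- (real (Suc n) * ln 2)) \<le> elog (t + 1 / 2 ^ Suc n)"
    by (simp only: elog_def not_le[symmetric] if_False ereal_less_eq)
  then have "ereal c * ereal (- (real (Suc n) * ln 2)) \<le> ereal c * elog (t + 1 / 2 ^ Suc n)"
    by (intro ereal_mult_left_mono) (simp_all add: c_def)
  from add_mono[OF add_mono[OF Suc this] order_refl[of "ereal (- c * ln 4)"]]
  have "log_sum (Suc n) (vec (of_real (3 + t)))
      \<ge> ereal (ln 3 - ln 2 / 8 * (4 - (real n + 4) / 2 ^ n) + c * - (real (Suc n) * ln 2) - c * ln 4)"
    unfolding log_sum.simps vec_component d c_def by simp
  moreover have "ln (4 :: real) = 2 * ln 2" using ln_realpow[of 2 2] by simp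
  then have "ln 3 - ln 2 / 8 * (4 - (real n + 4) / 2 ^ n) + c * - (real (Suc n) * ln 2) - c * ln 4
      = ln 3 - ln 2 / 8 * (4 - (real (Suc n) + 4) / 2 ^ Suc n)"
    by (simp add: c_def field_simps)
  ultimately show ?case by (simp only:)
qed

text \<open>A finite sum controls only the first \<open>n\<close> intervals; the others and the point \<open>3\<close> lie in a disc
  of radius \<open>2\<^sup>-\<^sup>n\<close> about \<open>3\<close>, where an extra pole of weight \<open>2 / n\<close> at \<open>3\<close> contributes at most
  \<open>- ln 4 < - ln 3\<close>. At a fixed point \<open>3 + t\<close> this pole becomes negligible as \<open>n\<close> grows, and the
  total mass tends to \<open>9/8\<close>, which explains the denominator.\<close>

lemma V_H_ge_right_of_3:
  assumes "t > 0"
  shows "V_H (vec (of_real (3 + t))) \<ge> ereal ((8 * ln 3 - 4 * ln 2) / 9)"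
proof -
  define x :: "complex^1" where "x = vec (of_real (3 + t))"
  have cx: "cmod (3 + complex_of_real t) = 3 + t"
    using assms by (metis abs_of_pos add_pos_pos norm_of_real of_real_add of_real_numeral zero_less_numeral)
  obtain VV where VV: "V_H x = ereal VV"
    using V_H_nonneg[of x] V_H_le_log[of "of_real (3 + t)"] assms cx unfolding x_def
    by (cases "V_H (vec (of_real (3 + t)))") auto
  define A where "A n = (ln 3 - ln 2 / 2 + 2 / real n * (ln t - ln 4)) / (9/8 + 2 / real n)" for n
  have "A n \<le> VV" if n: "n \<ge> 1" for n
  proof -
    define c where "c = 2 / real n"
    have c: "c > 0" using n by (simp add: c_def)
    define m where "m = 1 / (9/8 + c)"
    have m: "m > 0" using c by (simp add: m_def)
    define U where "U z = log_sum n z + ereal c * elog (cmod (z $ 1 - 3)) + ereal (- c * ln 4)" for z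
    have "log_sum n \<in> Lelong (9/8)"
      by (rule Lelong_mono[OF log_sum_Lelong]) simp
    from Lelong_cmult[OF Lelong_add_const[OF Lelong_add_log[OF this c]] m]
    have "(\<lambda>z. ereal m * U z) \<in> Lelong (m * (9/8 + c))" unfolding U_def .
    moreover have "m * (9/8 + c) = 1" using c by (simp add: m_def)
    ultimately have L: "(\<lambda>z. ereal m * U z) \<in> Lelong 1" by simp
    have "ereal m * U x \<le> V_H x"
    proof (rule extremal_upper[OF L])
      fix z :: "complex^1"
      assume "z \<in> {z. z $ 1 \<in> set_H}"
      then consider "cmod (z $ 1) \<le> 1" | "z $ 1 \<in> set_I" by (auto simp: set_H_def)
      then have "U z \<le> ereal 0"
      proof cases
        case 1
        have "cmod (z $ 1 - 3) \<le> cmod (z $ 1) + cmod 3" by (rule norm_triangle_ineq4)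
        then have "cmod (z $ 1 - 3) \<le> 4" using 1 by simp
        then show ?thesis
          using add_log_term_le[OF c _ _ log_sum_le_on_disc[OF 1], of _ 4 n] by (simp add: U_def)
      next
        case 2
        then obtain s where s: "z $ 1 = of_real s" "2 \<le> s" "s \<le> 3" by (rule set_I_real)
        have d: "cmod (z $ 1 - 3) = \<bar>s - 3\<bar>"
          unfolding s(1) by (metis norm_of_real of_real_diff of_real_numeral)
        from 2 show ?thesis
        proof (cases rule: set_I_cases)
          case 1
          then have "U z = -\<infinity>" using c log_sum_le_on_I(1)[OF s, of n] by (cases "log_sum n z") (auto simp: U_def elog_def)
          then show ?thesis by simp
        next
          case (2 j t')
          then have j: "j \<ge> 1" "\<bar>s - q_seq j\<bar> \<le> r_seq j" using s(1) by auto
          show ?thesis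
          proof (cases "j \<le> n")
            case True
            have "log_sum n z \<le> ereal (ln 3 - 2)"
              using log_sum_le_on_I(2)[OF s j, of "n - j"] True by simp
            from add_log_term_le[OF c _ _ this, of "cmod (z $ 1 - 3)" 4]
            have "U z \<le> ereal (ln 3 - 2)" using d s by (simp add: U_def)
            also have "ln (3::real) \<le> 3 - 1" by (rule ln_le_minus_one) simp
            then have "ereal (ln 3 - 2) \<le> ereal 0" by simp
            finally show ?thesis .
          next
            case False
            have "(2::real) ^ Suc n \<le> 2 ^ j" using False by (intro power_increasing) auto
            then have "2 / 2 ^ j \<le> 1 / (2::real) ^ n" by (simp add: field_simps)
            then have "\<bar>s - 3\<bar> \<le> 1 / 2 ^ n" using j(2) r_seq_le[of j] s(3) unfolding q_seq_def by linarith
            then have "U z \<le> ereal (ln 3 + c * (ln (1 / 2 ^ n) - ln 4))"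
              unfolding U_def d by (intro add_log_term_le c log_sum_le_on_I(1)[OF s]) auto
            also have "\<dots> \<le> ereal 0"
            proof -
              have "ln (1 / 2 ^ n :: real) = - (real n * ln 2)" by (simp add: ln_div ln_realpow)
              moreover have l4: "ln (4 :: real) = 2 * ln 2" using ln_realpow[of 2 2] by simp
              ultimately have "c * (ln (1 / 2 ^ n) - ln 4) = - (ln 4) - c * ln 4" using n by (simp add: c_def field_simps)
              moreover have "ln 3 \<le> ln (4::real)" by (intro ln_mono) auto
              moreover have "c * ln 4 \<ge> 0" using c by simp
              ultimately have "ln 3 + c * (ln (1 / 2 ^ n) - ln 4) \<le> 0" by linarith
              then show ?thesis by simp
            qed
            finally show ?thesis .
          qed
        qed
      qed
      from ereal_mult_left_mono[OF this, of "ereal m"] m show "ereal m * U z \<le> ereal 0" by simp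
    qed
    moreover have "ereal (ln 3 - ln 2 / 2 + c * (ln t - ln 4)) \<le> U x"
    proof -
      have "ln 3 - ln 2 / 2 \<le> ln 3 - ln 2 / 8 * (4 - (real n + 4) / 2 ^ n)"
      proof -
        have "0 \<le> ln 2 / 8 * ((real n + 4) / 2 ^ n)" by simp
        then show ?thesis by (simp add: algebra_simps)
      qed
      then have "ereal (ln 3 - ln 2 / 2) \<le> log_sum n x"
        using log_sum_ge_right_of_3[OF assms, of n] unfolding x_def by (meson ereal_less_eq(3) order_trans)
      moreover have "elog (cmod (x $ 1 - 3)) = ereal (ln t)" using assms by (simp add: x_def elog_def)
      ultimately show ?thesis
        unfolding U_def using add_right_mono[of "ereal (ln 3 - ln 2 / 2)" "log_sum n x" "ereal (c * ln t - c * ln 4)"]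
        by (cases "log_sum n x") (auto simp: algebra_simps)
    qed
    then have "ereal m * ereal (ln 3 - ln 2 / 2 + c * (ln t - ln 4)) \<le> ereal m * U x"
      using m by (intro ereal_mult_left_mono) auto
    ultimately have "ereal m * ereal (ln 3 - ln 2 / 2 + c * (ln t - ln 4)) \<le> ereal VV" using VV order_trans by metis
    then show ?thesis by (simp add: A_def m_def c_def)
  qed
  moreover have "A \<longlonglongrightarrow> (ln 3 - ln 2 / 2 + 0 * (ln t - ln 4)) / (9/8 + 0)"
    unfolding A_def by (intro tendsto_intros lim_const_over_n) auto
  ultimately have "(ln 3 - ln 2 / 2 + 0 * (ln t - ln 4)) / (9/8 + 0) \<le> VV"
    by (intro LIMSEQ_le_const2) auto
  then show ?thesis using VV by (simp add: x_def field_simps)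
qed

text \<open>The bound holds at points \<open>3 + t\<close> arbitrarily close to \<open>3\<close>, hence for the regularisation at \<open>3\<close>
  itself, although \<open>3 \<in> H\<close>.\<close>

proposition V_H_star_ge: "V_H_star 3 \<ge> ereal ((8 * ln 3 - 4 * ln 2) / 9)"
proof (rule ccontr)
  assume "\<not> ?thesis"
  then have "V_H_star 3 < ereal ((8 * ln 3 - 4 * ln 2) / 9)" by simp
  then have "eventually (\<lambda>x. V_H x < ereal ((8 * ln 3 - 4 * ln 2) / 9)) (nhds (vec 3))"
    unfolding V_H_star_def by (rule usc_reg_lessD)
  then obtain d where d: "d > 0" "\<And>x. dist x (vec 3) < d \<Longrightarrow> V_H x < ereal ((8 * ln 3 - 4 * ln 2) / 9)"
    unfolding eventually_nhds_metric by blast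
  have "dist (vec (of_real (3 + d/2)) :: complex^1) (vec 3) = d/2"
    using d by (simp add: dist_norm norm_vec1)
  then have "V_H (vec (of_real (3 + d/2))) < ereal ((8 * ln 3 - 4 * ln 2) / 9)" using d by simp
  then show False using V_H_ge_right_of_3[of "d/2"] d by simp
qed

section \<open>The regularisation of \<open>V\<^sub>K\<close> vanishes at \<open>a\<close>\<close>

text \<open>The real part of the fourth root. It is harmonic off the negative half-axis, continuous
  everywhere, vanishes at \<open>0\<close>, and unlike the square root it stays away from \<open>0\<close> on circles, up to
  and including the slit.\<close>

definition slit_barrier :: "complex \<Rightarrow> real" where
  "slit_barrier v = sqrt ((sqrt (cmod v) + sqrt ((cmod v + Re v) / 2)) / 2)"

lemma slit_barrier_eq: "slit_barrier v = Re (csqrt (csqrt v))"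
  by (simp add: slit_barrier_def)

lemma slit_barrier_continuous: "continuous_on A f \<Longrightarrow> continuous_on A (\<lambda>x. slit_barrier (f x))"
  unfolding slit_barrier_def by (intro continuous_intros) auto

lemma slit_barrier_ge: "slit_barrier v \<ge> sqrt (sqrt (cmod v) / 2)"
proof -
  have "0 \<le> cmod v + Re v" using abs_Re_le_cmod[of v] by linarith
  then show ?thesis unfolding slit_barrier_def by (intro real_sqrt_le_mono divide_right_mono) auto
qed

lemma loc_harmonic_slit_barrier:
  assumes c: "a - c \<notin> \<real>\<^sub>\<le>\<^sub>0"
  shows "loc_harmonic (\<lambda>w. slit_barrier (a - w)) c"
proof -
  have "open ((\<lambda>w. a - w) -` (- \<real>\<^sub>\<le>\<^sub>0))"
    by (intro open_vimage continuous_intros open_Compl closed_nonpos_Reals_complex)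
  moreover have "c \<in> (\<lambda>w. a - w) -` (- \<real>\<^sub>\<le>\<^sub>0)" using c by simp
  ultimately obtain R where R: "R > 0" "ball c R \<subseteq> (\<lambda>w. a - w) -` (- \<real>\<^sub>\<le>\<^sub>0)"
    using openE by blast
  have 1: "a - w \<notin> \<real>\<^sub>\<le>\<^sub>0" if "w \<in> ball c R" for w using R(2) that by blast
  have 2: "csqrt (a - w) \<notin> \<real>\<^sub>\<le>\<^sub>0" if "w \<in> ball c R" for w
  proof
    assume "csqrt (a - w) \<in> \<real>\<^sub>\<le>\<^sub>0"
    then have "Re (csqrt (a - w)) \<le> 0" "Im (csqrt (a - w)) = 0"
      by (simp_all only: complex_nonpos_Reals_iff)
    moreover have "Re (csqrt (a - w)) \<ge> 0" by (rule Re_csqrt)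
    ultimately have "csqrt (a - w) = 0" by (simp only: complex_eq_iff zero_complex.simps) simp
    then have "a - w = 0" by (simp only: csqrt_eq_0)
    then show False using 1[OF that] by simp
  qed
  have "(\<lambda>w. csqrt (csqrt (a - w))) holomorphic_on ball c R"
    using 1 2 by (intro holomorphic_intros)
  then show ?thesis unfolding loc_harmonic_def slit_barrier_eq using R(1) by blast
qed

lemma K_competitor_le_log:
  assumes u: "u \<in> Lelong 1" "\<And>p. p \<in> set_K \<Longrightarrow> u p \<le> ereal 0" and p: "norm p \<ge> 1"
  shows "u p \<le> ereal (ln (norm p))"
proof -
  have "u p \<le> ereal (0 + 1 * ln (norm p))"
    by (rule Lelong_Bernstein_Walsh[OF u(1)]) (use u(2) p in \<open>auto simp: set_K_def set_A_eq\<close>)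
  then show ?thesis by simp
qed

lemma K_competitor_le_ln5:
  assumes u: "u \<in> Lelong 1" "\<And>p. p \<in> set_K \<Longrightarrow> u p \<le> ereal 0"
    and z: "cmod z \<le> 1" and w: "2 \<le> cmod w" "cmod w \<le> 4"
  shows "u (vector [z, w]) \<le> ereal (ln 5)"
proof -
  let ?p = "vector [z, w] :: complex^2"
  have n: "(norm ?p)\<^sup>2 = (cmod z)\<^sup>2 + (cmod w)\<^sup>2" by (simp add: norm_complex2)
  have "(cmod z)\<^sup>2 \<le> 1\<^sup>2" using z by (rule power_mono) simp
  moreover have "(cmod w)\<^sup>2 \<le> 4\<^sup>2" using w(2) by (rule power_mono) simp
  ultimately have "(norm ?p)\<^sup>2 \<le> 5\<^sup>2" unfolding n by simp
  then have n5: "norm ?p \<le> 5" by (rule power2_le_imp_le) simp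
  have "cmod (?p $ 2) \<le> norm ?p" by (rule Finite_Cartesian_Product.norm_nth_le)
  then have n1: "norm ?p \<ge> 1" using w by simp
  have "u ?p \<le> ereal (ln (norm ?p))" by (rule K_competitor_le_log[OF u n1])
  also have "ln (norm ?p) \<le> ln 5" using n5 n1 by (intro ln_mono) auto
  finally show ?thesis by simp
qed

text \<open>The slice of \<open>\<Gamma>\<close> at height \<open>t\<close> is the unit circle with a small arc around \<open>1\<close> removed, the arc
  shrinking as \<open>t\<close> decreases to \<open>3\<close>.\<close>

lemma Gamma_circle_mem:
  assumes "cmod \<zeta> = 1" "3 \<le> t" "2 * (t - 3) \<le> (cmod (\<zeta> - 1))\<^sup>2"
  shows "vector [\<zeta>, complex_of_real t] \<in> set_Gamma"
proof -
  define \<theta> where "\<theta> = Arg \<zeta>"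
  have \<zeta>: "\<zeta> = cis \<theta>" using rcis_cmod_Arg[of \<zeta>] assms by (simp add: \<theta>_def rcis_def)
  have "(cmod (\<zeta> - 1))\<^sup>2 = (cos \<theta> - 1)\<^sup>2 + (sin \<theta>)\<^sup>2" unfolding \<zeta> cmod_power2 by simp
  also have "\<dots> = 2 - 2 * cos \<theta>" using sin_cos_squared_add[of \<theta>] by (simp add: power2_eq_square algebra_simps)
  finally have "t \<le> 4 - cos \<theta>" using assms by simp
  moreover have "- pi \<le> \<theta>" "\<theta> \<le> pi" using mpi_less_Arg[of \<zeta>] Arg_le_pi[of \<zeta>] by (simp_all add: \<theta>_def)
  ultimately show ?thesis unfolding set_Gamma_def \<zeta> using assms(2) by blast
qed

lemma vector2_line_1: "(vector [z, w] :: complex^2) = vector [0, w] + z *s vector [1, 0]"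
  and vector2_line_2: "(vector [z, w] :: complex^2) = vector [z, 0] + w *s vector [0, 1]"
  by (simp_all add: vec_eq_iff forall_2)

text \<open>On the disc at height \<open>t\<close> the competitor is nonpositive on the boundary except on an arc inside
  the disc of radius \<open>d\<close> about \<open>1\<close>, where it is at most \<open>ln 5\<close>. The harmonic function
  \<open>ln (3 / |\<zeta> - 1 - d|)\<close>, with its pole just outside the unit disc, is nonnegative on the
  boundary and large on that arc; after scaling it majorises \<open>u\<close>, and for \<open>|z| \<le> 1/2\<close> it is small once \<open>d\<close> is.\<close>

lemma K_competitor_small_near_slice:
  assumes u: "u \<in> Lelong 1" "\<And>p. p \<in> set_K \<Longrightarrow> u p \<le> ereal 0"
    and d: "0 < d" "d \<le> 1" and t: "3 \<le> t" "t \<le> 3 + d\<^sup>2 / 2" and z: "cmod z \<le> 1/2"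
  shows "u (vector [z, of_real t]) \<le> ereal (ln 5 * ln 6 / ln (3 / (2 * d)))"
proof -
  have pu: "psh u" using u by (simp add: Lelong_def)
  define L where "L = ln (3 / (2 * d))"
  have L: "L > 0" using d unfolding L_def by (intro ln_gt_zero) (auto simp: field_simps)
  have "d\<^sup>2 \<le> 1" using d by (simp add: power_le_one)
  then have t4: "t \<le> 4" using t by simp
  define h where "h \<zeta> = ln 5 * ln 3 / L + - (ln 5 / L) * ln (cmod (- (1 + of_real d) + \<zeta> * 1))" for \<zeta> :: complex
  have hh: "h \<zeta> = ln 5 / L * (ln 3 - ln (cmod (\<zeta> - 1 - of_real d)))" for \<zeta>
  proof -
    have eq: "- (1 + of_real d) + \<zeta> * 1 = \<zeta> - 1 - of_real d" by simp
    show ?thesis unfolding h_def eq by (simp add: right_diff_distrib)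
  qed
  have nz: "- (1 + of_real d) + \<zeta> * 1 \<noteq> 0" if "cmod \<zeta> \<le> 1" for \<zeta>
  proof
    assume "- (1 + of_real d) + \<zeta> * 1 = 0"
    then have "\<zeta> = of_real (1 + d)" by (simp add: add_eq_0_iff)
    then have "cmod \<zeta> = 1 + d" using d by (simp only: norm_of_real)
    then show False using that d by simp
  qed
  have "u (vector [0, of_real t] + z *s vector [1, 0]) \<le> ereal (h z)"
  proof (rule maximum_principle[of _ "ball 0 1"])
    have sub: "subharmonic (\<lambda>\<zeta>. u (vector [0, of_real t] + \<zeta> *s vector [1, 0]))" by (rule psh_line[OF pu])
    then show "usc (\<lambda>\<zeta>. u (vector [0, of_real t] + \<zeta> *s vector [1, 0]))" by (simp add: subharmonic_def)
    show "u (vector [0, of_real t] + \<zeta> *s vector [1, 0]) < \<infinity>" for \<zeta> by (rule psh_less_infinity[OF pu])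
    show "loc_submean (\<lambda>\<zeta>. u (vector [0, of_real t] + \<zeta> *s vector [1, 0])) c" for c
      by (rule subharmonic_imp_loc_submean[OF sub])
    show "continuous_on (closure (ball 0 1)) h"
      unfolding h_def by (intro continuous_intros) (use nz in auto)
    show "loc_harmonic h c" if "c \<in> ball 0 1" for c
      unfolding h_def
    proof (intro loc_harmonic_add loc_harmonic_const loc_harmonic_cmult loc_harmonic_ln_affine)
      show "- (1 + complex_of_real d) + c * 1 \<noteq> 0" using that by (intro nz) simp
    qed
    fix \<zeta> :: complex
    assume "\<zeta> \<in> closure (ball 0 1)" "\<zeta> \<notin> ball 0 1"
    then have \<zeta>: "cmod \<zeta> = 1" by simp
    have pos: "cmod (\<zeta> - 1 - of_real d) > 0" using nz[of \<zeta>] \<zeta> by (simp add: algebra_simps)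
    show "u (vector [0, of_real t] + \<zeta> *s vector [1, 0]) \<le> ereal (h \<zeta>)"
      unfolding vector2_line_1[symmetric]
    proof (cases "cmod (\<zeta> - 1) \<ge> d")
      case True
      then have "d\<^sup>2 \<le> (cmod (\<zeta> - 1))\<^sup>2" using d by (intro power_mono) auto
      then have "vector [\<zeta>, complex_of_real t] \<in> set_Gamma"
        using t \<zeta> by (intro Gamma_circle_mem) auto
      then have "u (vector [\<zeta>, of_real t]) \<le> ereal 0" by (intro u(2)) (simp add: set_K_def set_B_def)
      also have "0 \<le> h \<zeta>"
      proof -
        have "cmod (\<zeta> - 1 - of_real d) \<le> cmod (\<zeta> - 1) + cmod (of_real d)" by (rule norm_triangle_ineq4)
        also have "cmod (\<zeta> - 1) \<le> cmod \<zeta> + cmod 1" by (rule norm_triangle_ineq4)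
        finally have "cmod (\<zeta> - 1 - of_real d) \<le> 3" using \<zeta> d by simp
        then have "ln (cmod (\<zeta> - 1 - of_real d)) \<le> ln 3" using pos by (intro ln_mono)
        then show ?thesis unfolding hh using L by simp
      qed
      finally show "u (vector [\<zeta>, of_real t]) \<le> ereal (h \<zeta>)" by simp
    next
      case False
      have "u (vector [\<zeta>, of_real t]) \<le> ereal (ln 5)"
        by (rule K_competitor_le_ln5[OF u]) (use \<zeta> t t4 in auto)
      also have "ln 5 \<le> h \<zeta>"
      proof -
        have "cmod (\<zeta> - 1 - of_real d) \<le> cmod (\<zeta> - 1) + cmod (of_real d)" by (rule norm_triangle_ineq4)
        then have "cmod (\<zeta> - 1 - of_real d) \<le> 2 * d" using False d by simp
        then have "ln (cmod (\<zeta> - 1 - of_real d)) \<le> ln (2 * d)" using pos by (intro ln_mono)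
        moreover have "L = ln 3 - ln (2 * d)" unfolding L_def using d by (subst ln_div) auto
        ultimately have "L \<le> ln 3 - ln (cmod (\<zeta> - 1 - of_real d))" by simp
        then have "ln 5 / L * L \<le> ln 5 / L * (ln 3 - ln (cmod (\<zeta> - 1 - of_real d)))"
          using L by (intro mult_left_mono) auto
        then show ?thesis unfolding hh using L by simp
      qed
      finally show "u (vector [\<zeta>, of_real t]) \<le> ereal (h \<zeta>)" by simp
    qed
  qed (use z in auto)
  also have "h z \<le> ln 5 * ln 6 / L"
  proof -
    have "cmod (of_real (1 + d)) \<le> cmod (of_real (1 + d) - z) + cmod z" by (metis diff_add_cancel norm_triangle_ineq)
    moreover have "cmod (of_real (1 + d)) = 1 + d" using d by (simp only: norm_of_real)
    moreover have "cmod (of_real (1 + d) - z) = cmod (z - 1 - of_real d)"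
      by (subst norm_minus_commute) (simp add: algebra_simps)
    ultimately have "1/2 \<le> cmod (z - 1 - of_real d)" using z d by simp
    then have "ln (1/2) \<le> ln (cmod (z - 1 - of_real d))" by (intro ln_mono) auto
    moreover have "ln (6::real) = ln 3 - ln (1/2)" using ln_mult_pos[of 3 2] by (simp add: ln_div)
    ultimately have "ln 3 - ln (cmod (z - 1 - of_real d)) \<le> ln 6" by simp
    then have "ln 5 / L * (ln 3 - ln (cmod (z - 1 - of_real d))) \<le> ln 5 / L * ln 6"
      using L by (intro mult_left_mono) auto
    then show ?thesis unfolding hh by simp
  qed
  finally show ?thesis unfolding vector2_line_1[symmetric] L_def by simp
qed

text \<open>Fix \<open>z\<close> and vary \<open>w\<close> in a small disc around \<open>3\<close>, slit along the reals to the right of \<open>3\<close>. On the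
  slit the previous lemma applies, on the circle \<open>u \<le> ln 5\<close>, and \<open>slit_barrier\<close> interpolates:
  a segment is regular at its end point.\<close>

lemma K_competitor_small_near_a:
  assumes u: "u \<in> Lelong 1" "\<And>p. p \<in> set_K \<Longrightarrow> u p \<le> ereal 0"
    and d: "0 < d" "d \<le> 1" and z: "cmod z \<le> 1/2" and w: "cmod (w - 3) < d\<^sup>2 / 2"
  shows "u (vector [z, w]) \<le> ereal (ln 5 * ln 6 / ln (3 / (2 * d)) + ln 5 / sqrt (sqrt (d\<^sup>2 / 2) / 2) * slit_barrier (3 - w))"
proof -
  have pu: "psh u" using u by (simp add: Lelong_def)
  define \<eta> where "\<eta> = d\<^sup>2 / 2"
  have "d\<^sup>2 \<le> 1" using d by (simp add: power_le_one)
  then have \<eta>: "0 < \<eta>" "\<eta> \<le> 1" using d by (auto simp: \<eta>_def)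
  define \<epsilon> where "\<epsilon> = ln 5 * ln 6 / ln (3 / (2 * d))"
  have "ln (3 / (2 * d)) \<ge> 0" using d by (intro ln_ge_zero) (auto simp: field_simps)
  then have \<epsilon>: "\<epsilon> \<ge> 0" by (simp add: \<epsilon>_def)
  define m where "m = ln 5 / sqrt (sqrt \<eta> / 2)"
  have m: "m \<ge> 0" using \<eta> by (simp add: m_def)
  define h where "h w = \<epsilon> + m * slit_barrier (3 - w)" for w
  have sb: "slit_barrier v \<ge> 0" for v using slit_barrier_ge[of v] by (rule order_trans[rotated]) simp
  have slit: "u (vector [z, 3 + of_real x]) \<le> ereal (h (3 + of_real x))" if x: "0 \<le> x" "x \<le> \<eta>" for x
  proof -
    have "u (vector [z, of_real (3 + x)]) \<le> ereal \<epsilon>"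
      unfolding \<epsilon>_def by (rule K_competitor_small_near_slice[OF u d _ _ z]) (use x in \<open>auto simp: \<eta>_def\<close>)
    also have "\<epsilon> \<le> h (3 + of_real x)" unfolding h_def using m sb by simp
    finally show ?thesis by simp
  qed
  define S :: "complex set" where "S = (\<lambda>w. 3 - w) -` \<real>\<^sub>\<le>\<^sub>0"
  have S: "closed S" unfolding S_def
    by (intro closed_vimage continuous_intros closed_nonpos_Reals_complex)
  have S_cases: "\<exists>x. 0 \<le> x \<and> x \<le> \<eta> \<and> w = 3 + of_real x" if "w \<in> S" "cmod (w - 3) \<le> \<eta>" for w
  proof -
    have "Re (3 - w) \<le> 0" "Im (3 - w) = 0" using that by (simp_all only: S_def vimage_eq complex_nonpos_Reals_iff)
    then have w: "w = 3 + of_real (Re w - 3)" "0 \<le> Re w - 3" by (simp_all add: complex_eq_iff)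
    have "Re w - 3 \<le> \<eta>" using complex_Re_le_cmod[of "w - 3"] that(2) by simp
    with w show ?thesis by blast
  qed
  have "u (vector [z, w]) \<le> ereal (h w)"
  proof (cases "w \<in> S")
    case True
    have "cmod (w - 3) \<le> \<eta>" using w by (simp add: \<eta>_def)
    from S_cases[OF True this] show ?thesis using slit by blast
  next
    case False
    define U where "U = ball 3 \<eta> - S"
    have cl: "closure U \<subseteq> cball 3 \<eta>" by (rule closure_minimal) (auto simp: U_def)
    have "u (vector [z, 0] + w *s vector [0, 1]) \<le> ereal (h w)"
    proof (rule maximum_principle[of _ U])
      have sub: "subharmonic (\<lambda>\<zeta>. u (vector [z, 0] + \<zeta> *s vector [0, 1]))" by (rule psh_line[OF pu])
      then show "usc (\<lambda>\<zeta>. u (vector [z, 0] + \<zeta> *s vector [0, 1]))" by (simp add: subharmonic_def)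
      show "u (vector [z, 0] + \<zeta> *s vector [0, 1]) < \<infinity>" for \<zeta> by (rule psh_less_infinity[OF pu])
      show "loc_submean (\<lambda>\<zeta>. u (vector [z, 0] + \<zeta> *s vector [0, 1])) c" for c
        by (rule subharmonic_imp_loc_submean[OF sub])
      show "open U" unfolding U_def using S by (intro open_Diff) auto
      show "bounded U" unfolding U_def by (rule bounded_subset[OF bounded_ball]) auto
      show "w \<in> U" using False w by (simp add: U_def \<eta>_def dist_norm norm_minus_commute)
      show "continuous_on (closure U) h"
        unfolding h_def by (intro continuous_intros slit_barrier_continuous)
      show "loc_harmonic h c" if "c \<in> U" for c
        unfolding h_def
        by (intro loc_harmonic_add loc_harmonic_const loc_harmonic_cmult loc_harmonic_slit_barrier)
           (use that in \<open>auto simp: U_def S_def\<close>)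
      fix \<zeta> :: complex
      assume \<zeta>: "\<zeta> \<in> closure U" "\<zeta> \<notin> U"
      then have le: "cmod (\<zeta> - 3) \<le> \<eta>" using cl by (auto simp: dist_norm norm_minus_commute)
      show "u (vector [z, 0] + \<zeta> *s vector [0, 1]) \<le> ereal (h \<zeta>)"
        unfolding vector2_line_2[symmetric]
      proof (cases "\<zeta> \<in> S")
        case True
        then show "u (vector [z, \<zeta>]) \<le> ereal (h \<zeta>)" using S_cases[OF True le] slit by blast
      next
        case False
        then have eq: "cmod (3 - \<zeta>) = \<eta>" using \<zeta> le by (auto simp: U_def dist_norm norm_minus_commute)
        have z1: "cmod z \<le> 1" using z by linarith
        have "u (vector [z, \<zeta>]) \<le> ereal (ln 5)"
        proof (rule K_competitor_le_ln5[OF u z1])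
          have "3 - cmod \<zeta> \<le> cmod (3 - \<zeta>)" "cmod \<zeta> - 3 \<le> cmod (\<zeta> - 3)"
            using norm_triangle_ineq2[of 3 \<zeta>] norm_triangle_ineq2[of \<zeta> 3] by simp_all
          then show "2 \<le> cmod \<zeta>" "cmod \<zeta> \<le> 4" using eq le \<eta> by linarith+
        qed
        also have "ln 5 \<le> h \<zeta>"
        proof -
          have "m * sqrt (sqrt \<eta> / 2) \<le> m * slit_barrier (3 - \<zeta>)"
            using slit_barrier_ge[of "3 - \<zeta>"] m unfolding eq by (intro mult_left_mono) auto
          moreover have "m * sqrt (sqrt \<eta> / 2) = ln 5" using \<eta> by (simp add: m_def)
          ultimately show ?thesis unfolding h_def using \<epsilon> by simp
        qed
        finally show "u (vector [z, \<zeta>]) \<le> ereal (h \<zeta>)" by simp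
      qed
    qed
    then show ?thesis unfolding vector2_line_2[symmetric] .
  qed
  then show ?thesis by (simp add: h_def m_def \<epsilon>_def \<eta>_def)
qed

lemma pt_a_nth [simp]: "pt_a $ 1 = 0" "pt_a $ 2 = 3" by (simp_all add: pt_a_def)

lemma eventually_near_pt_a:
  assumes "r > 0"
  shows "eventually (\<lambda>p. cmod (p $ 1) < r \<and> cmod (p $ 2 - 3) < r) (nhds pt_a)"
  unfolding eventually_nhds_metric
proof (intro exI conjI allI impI)
  fix p :: "complex^2"
  assume d: "dist p pt_a < r"
  have "cmod ((p - pt_a) $ 1) \<le> norm (p - pt_a)" "cmod ((p - pt_a) $ 2) \<le> norm (p - pt_a)"
    by (rule Finite_Cartesian_Product.norm_nth_le)+
  then show "cmod (p $ 1) < r" "cmod (p $ 2 - 3) < r" using d by (auto simp: dist_norm)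
qed (rule assms)

text \<open>At \<open>a\<close> itself the barrier term vanishes.\<close>

lemma V_K_star_le:
  assumes d: "0 < d" "d \<le> 1"
  shows "V_K_star pt_a \<le> ereal (ln 5 * ln 6 / ln (3 / (2 * d)))"
proof -
  define m where "m = ln 5 / sqrt (sqrt (d\<^sup>2 / 2) / 2)"
  define g where "g p = ln 5 * ln 6 / ln (3 / (2 * d)) + m * slit_barrier (3 - p $ 2)" for p :: "complex^2"
  have d2: "d\<^sup>2 / 2 > 0" using d by simp
  have "V_K_star pt_a \<le> ereal (g pt_a)"
    unfolding V_K_star_def
  proof (rule usc_reg_le)
    have "min (1/2) (d\<^sup>2 / 2) > 0" using d2 by simp
    from eventually_near_pt_a[OF this]
    show "eventually (\<lambda>p. extremal 1 set_K (\<lambda>_. 0) p \<le> ereal (g p)) (nhds pt_a)"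
    proof eventually_elim
      case (elim p)
      show ?case
      proof (rule extremal_least)
        fix u :: "complex^2 \<Rightarrow> ereal"
        assume u: "u \<in> Lelong 1" "\<And>p. p \<in> set_K \<Longrightarrow> u p \<le> ereal 0"
        have "u (vector [p $ 1, p $ 2]) \<le> ereal (g p)"
          unfolding g_def m_def by (rule K_competitor_small_near_a[OF u d]) (use elim in auto)
        moreover have "vector [p $ 1, p $ 2] = p" by (simp add: vec_eq_iff forall_2)
        ultimately show "u p \<le> ereal (g p)" by simp
      qed
    qed
    have "continuous_on UNIV g" unfolding g_def by (intro continuous_intros slit_barrier_continuous)
    then show "isCont g pt_a" by (simp add: continuous_on_eq_continuous_at)
  qed
  moreover have "slit_barrier 0 = 0" by (simp add: slit_barrier_def)
  ultimately show ?thesis by (simp add: g_def)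
qed

proposition V_K_star_pt_a: "V_K_star pt_a = 0"
proof (rule antisym)
  have "0 \<le> extremal 1 set_K (\<lambda>_. 0) pt_a"
    using extremal_upper[OF Lelong_zero[of 1], of set_K "\<lambda>_. 0" pt_a] by simp
  also have "\<dots> \<le> V_K_star pt_a" unfolding V_K_star_def by (rule usc_reg_ge)
  finally show "0 \<le> V_K_star pt_a" .
  show "V_K_star pt_a \<le> 0"
  proof (rule ereal_le_epsilon2)
    fix e :: real
    assume e: "e > 0"
    define A where "A = ln 5 * ln (6 :: real)"
    define X where "X = max 1 (A / e)"
    have X: "X \<ge> 1" "A / e \<le> X" by (auto simp: X_def)
    \<comment> \<open>solves \<open>ln (3 / (2 * d)) = X\<close>; the lower bound \<open>1\<close> in \<open>X\<close> ensures \<open>d \<le> 1\<close>\<close>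
    define d where "d = 3 / 2 * exp (- X)"
    have "(2::real) \<le> exp 1" using exp_ge_add_one_self[of 1] by simp
    also have "exp 1 \<le> exp X" using X(1) by simp
    finally have "3 / 2 \<le> exp X" by simp
    then have "exp (- X) * (3 / 2) \<le> exp (- X) * exp X" by (rule mult_left_mono) (rule exp_ge_zero)
    also have inv: "exp (- X) * exp X = 1" unfolding exp_add[symmetric] by simp
    finally have d: "0 < d" "d \<le> 1" unfolding d_def using exp_gt_zero[of "- X"] by linarith+
    have "ln (3 / (2 * d)) = X"
    proof -
      have nz: "2 * d \<noteq> 0" using d by linarith
      have eq: "exp X * (2 * d) = 3 * (exp (- X) * exp X)" unfolding d_def by algebra
      have "3 / (2 * d) = exp X" unfolding nonzero_divide_eq_eq[OF nz] eq inv by simp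
      then show ?thesis by (simp only: ln_exp)
    qed
    then have "V_K_star pt_a \<le> ereal (A / X)" using V_K_star_le[OF d] by (simp only: A_def)
    also have "A / X \<le> e"
    proof -
      have "A \<le> X * e" using X(2) e by (simp add: pos_divide_le_eq)
      then show ?thesis using X(1) by (simp add: pos_divide_le_eq mult.commute)
    qed
    finally show "V_K_star pt_a \<le> 0 + ereal e" by simp
  qed
qed

section \<open>Passage to the regularisations\<close>

lemma eventually_nhds_compose:
  assumes "eventually P (nhds (f a))" "isCont f a"
  shows "eventually (\<lambda>x. P (f x)) (nhds a)"
proof -
  have "(f \<longlongrightarrow> f a) (nhds a)" using assms(2) by (simp add: isCont_def tendsto_at_iff_tendsto_nhds)
  then show ?thesis using assms(1) by (simp add: filterlim_iff)
qed

lemma norm_pt_a: "norm pt_a = 3"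
proof -
  have "(norm pt_a)\<^sup>2 = 3\<^sup>2" by (simp add: norm_complex2)
  then show ?thesis by (rule power2_eq_imp_eq) simp_all
qed

lemma V_H_star_real:
  obtains V where "V_H_star 3 = ereal V" "(8 * ln 3 - 4 * ln 2) / 9 \<le> V"
proof -
  have "V_H_star 3 \<le> ereal (ln (cmod ((vec 3 :: complex^1) $ 1)))"
    unfolding V_H_star_def
  proof (rule usc_reg_le)
    have "open {x :: complex^1. 1 < cmod (x $ 1)}" by (intro open_Collect_less continuous_intros)
    from eventually_nhds_in_open[OF this, of "vec 3"]
    have "eventually (\<lambda>x :: complex^1. 1 < cmod (x $ 1)) (nhds (vec 3))" by simp
    then show "eventually (\<lambda>x. V_H x \<le> ereal (ln (cmod (x $ 1)))) (nhds (vec 3))"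
    proof eventually_elim
      case (elim x)
      then show ?case using V_H_le_log[of "x $ 1"] by simp
    qed
    show "isCont (\<lambda>x :: complex^1. ln (cmod (x $ 1))) (vec 3)" by (intro continuous_intros) auto
  qed
  then show ?thesis using that V_H_star_ge by (cases "V_H_star 3") auto
qed

text \<open>Near \<open>a\<close> the correction \<open>ln (norm p / |w|)\<close> tends to \<open>0\<close>, and \<open>V\<^sub>H\<close> stays below any number
  larger than its regularisation.\<close>

lemma F_ext_upper:
  fixes \<Phi> :: "complex^2 \<Rightarrow> real"
  assumes in_ball: "\<And>z. norm z \<le> 1 \<Longrightarrow> \<Phi> z \<le> b"
    and outside: "\<And>z. norm z \<ge> 1 \<Longrightarrow> \<Phi> z = ln (norm z) + b"
    and \<tau>: "\<tau> > 0" and h: "h > 0" and V: "V_H_star 3 = ereal V"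
  shows "F_ext \<Phi> \<tau> (\<tau> + h) pt_a \<le> ereal (\<tau> * (ln 3 + b) + h * V)"
proof (rule ereal_le_epsilon2)
  fix e :: real
  assume e: "e > 0"
  define g where "g p = \<tau> * (ln (norm p) + b) + h * ln (norm p / cmod (p $ 2)) + h * (V + e / h)" for p :: "complex^2"
  have "V_H_star 3 < ereal (V + e / h)" using V e h by simp
  then have "eventually (\<lambda>x. V_H x < ereal (V + e / h)) (nhds (vec (pt_a $ 2)))"
    unfolding V_H_star_def by (simp add: usc_reg_lessD)
  moreover have "continuous_on UNIV (\<lambda>p :: complex^2. vec (p $ 2) :: complex^1)"
    unfolding vec_def by (intro continuous_intros)
  then have "isCont (\<lambda>p :: complex^2. vec (p $ 2) :: complex^1) pt_a"
    by (simp add: continuous_on_eq_continuous_at)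
  ultimately have ev: "eventually (\<lambda>p :: complex^2. V_H (vec (p $ 2)) < ereal (V + e / h)) (nhds pt_a)"
    by (rule eventually_nhds_compose)
  have "F_ext \<Phi> \<tau> (\<tau> + h) pt_a \<le> ereal (g pt_a)"
    unfolding F_ext_def
  proof (rule usc_reg_le)
    show "eventually (\<lambda>p. extremal (\<tau> + h) set_K (\<lambda>p. \<tau> * \<Phi> p) p \<le> ereal (g p)) (nhds pt_a)"
      using ev eventually_near_pt_a[of "1/2", simplified]
    proof eventually_elim
      case (elim p)
      have "3 - cmod (p $ 2) \<le> cmod (3 - p $ 2)" using norm_triangle_ineq2[of 3 "p $ 2"] by simp
      then have p2: "cmod (p $ 2) > 2" using elim by (simp add: norm_minus_commute)
      show ?case
      proof (rule extremal_least)
        fix u :: "complex^2 \<Rightarrow> ereal"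
        assume u: "u \<in> Lelong (\<tau> + h)" "\<And>p. p \<in> set_K \<Longrightarrow> u p \<le> ereal (\<tau> * \<Phi> p)"
        have "u p \<le> ereal (\<tau> * (ln (norm p) + b) + h * ln (norm p / cmod (p $ 2))) + ereal h * V_H (vec (p $ 2))"
          by (rule competitor_bound_near_axis[OF in_ball outside \<tau> h u]) (use elim p2 in auto)
        also have "\<dots> \<le> ereal (\<tau> * (ln (norm p) + b) + h * ln (norm p / cmod (p $ 2))) + ereal h * ereal (V + e / h)"
          using elim h by (intro add_left_mono ereal_mult_left_mono) auto
        finally show "u p \<le> ereal (g p)" by (simp add: g_def)
      qed
    qed
    show "isCont g pt_a" unfolding g_def by (intro continuous_intros) (simp_all add: norm_pt_a)
  qed
  also have "g pt_a = \<tau> * (ln 3 + b) + h * V + e"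
    using h by (simp add: g_def norm_pt_a distrib_left)
  finally show "F_ext \<Phi> \<tau> (\<tau> + h) pt_a \<le> ereal (\<tau> * (ln 3 + b) + h * V) + ereal e" by simp
qed

text \<open>Only the points \<open>(0, x)\<close> near \<open>a\<close> are used: a bound \<open>T\<close> for the weighted extremal function there
  is a bound for \<open>V\<^sub>H\<close> near \<open>3\<close>.\<close>

lemma F_ext_lower:
  fixes \<Phi> :: "complex^2 \<Rightarrow> real"
  assumes outside: "\<And>z. norm z \<ge> 1 \<Longrightarrow> \<Phi> z = ln (norm z) + b"
    and ge: "\<And>z. z \<noteq> 0 \<Longrightarrow> \<Phi> z \<ge> b + ln (norm z)"
    and \<tau>: "\<tau> > 0" and h: "0 < h" "h \<le> kappa \<tau>" and V: "V_H_star 3 = ereal V"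
  shows "ereal (\<tau> * (ln 3 + b) + h * V) \<le> F_ext \<Phi> \<tau> (\<tau> + h) pt_a"
proof (rule ccontr)
  assume "\<not> ?thesis"
  then have "F_ext \<Phi> \<tau> (\<tau> + h) pt_a < ereal (\<tau> * (ln 3 + b) + h * V)" by simp
  then obtain T where T: "F_ext \<Phi> \<tau> (\<tau> + h) pt_a < ereal T" "T < \<tau> * (ln 3 + b) + h * V"
    using ereal_dense2 by (metis ereal_less(2) less_ereal.simps(1))
  define \<iota> :: "complex^1 \<Rightarrow> complex^2" where "\<iota> x = x $ 1 *s vector [0, 1]" for x
  have \<iota>: "\<iota> x = vector [0, x $ 1]" for x by (simp add: \<iota>_def vec_eq_iff forall_2)
  have "continuous_on UNIV \<iota>" unfolding \<iota>_def by (intro continuous_intros)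
  then have "isCont \<iota> (vec 3)" by (simp add: continuous_on_eq_continuous_at)
  moreover have "\<iota> (vec 3) = pt_a" by (simp add: \<iota> pt_a_def)
  then have "eventually (\<lambda>p. extremal (\<tau> + h) set_K (\<lambda>p. \<tau> * \<Phi> p) p < ereal T) (nhds (\<iota> (vec 3)))"
    using T(1) unfolding F_ext_def by (simp add: usc_reg_lessD)
  ultimately have ev: "eventually (\<lambda>x. extremal (\<tau> + h) set_K (\<lambda>p. \<tau> * \<Phi> p) (\<iota> x) < ereal T) (nhds (vec 3))"
    by (rule eventually_nhds_compose[rotated])
  define g where "g x = (T - \<tau> * (b + ln (cmod (x $ 1)))) / h" for x :: "complex^1"
  have "V_H_star 3 \<le> ereal (g (vec 3))"
    unfolding V_H_star_def
  proof (rule usc_reg_le)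
    have "open {x :: complex^1. x $ 1 \<noteq> 0}" by (intro open_Collect_neq continuous_intros)
    from eventually_nhds_in_open[OF this, of "vec 3"]
    have "eventually (\<lambda>x :: complex^1. x $ 1 \<noteq> 0) (nhds (vec 3))" by simp
    with ev show "eventually (\<lambda>x. V_H x \<le> ereal (g x)) (nhds (vec 3))"
    proof eventually_elim
      case (elim x)
      then show ?case
        using V_H_bound_from_extremal[OF outside ge \<tau> h, of "x $ 1" T] unfolding g_def \<iota> by simp
    qed
    show "isCont g (vec 3)" unfolding g_def by (intro continuous_intros) (use h in auto)
  qed
  then have "V \<le> (T - \<tau> * (b + ln 3)) / h" using V by (simp add: g_def)
  then have "h * V \<le> T - \<tau> * (b + ln 3)" using h by (simp add: field_simps)
  then show False using T(2) by (simp add: algebra_simps)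
qed

theorem proposition7p3:
  fixes \<Phi> :: "complex^2 \<Rightarrow> real" and b \<tau> :: real
  assumes "b > 0"
    and "C_infinity \<Phi>"
    and "(\<lambda>z. ereal (\<Phi> z)) \<in> Lelong_plus 1"
    and "\<forall>z z'. norm z = norm z' \<longrightarrow> \<Phi> z = \<Phi> z'"
    and "\<forall>z. norm z \<le> 1 \<longrightarrow> 0 \<le> \<Phi> z \<and> \<Phi> z \<le> b"
    and "\<forall>z. norm z \<ge> 1 \<longrightarrow> \<Phi> z = ln (norm z) + b"
    and "\<forall>z. z \<noteq> 0 \<longrightarrow> \<Phi> z \<ge> b + ln (norm z)"
    and "\<forall>z. norm z > 1 \<longrightarrow> rank (complex_hessian \<Phi> z) = 1"
    and "\<tau> > 0"
  shows "(\<forall>h>0.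
            ereal (min h (kappa \<tau>)) * V_H_star 3
              \<le> F_ext \<Phi> \<tau> (\<tau> + h) pt_a - ereal (\<tau> * \<Phi> pt_a)
          \<and> F_ext \<Phi> \<tau> (\<tau> + h) pt_a - ereal (\<tau> * \<Phi> pt_a) \<le> ereal h * V_H_star 3)
       \<and> (\<forall>h. 0 \<le> h \<and> h \<le> kappa \<tau> \<longrightarrow>
            F_ext \<Phi> \<tau> (\<tau> + h) pt_a = ereal (\<tau> * \<Phi> pt_a) + ereal h * V_H_star 3)
       \<and> ((\<lambda>h. (F_ext \<Phi> \<tau> (\<tau> + h) pt_a - ereal (\<tau> * \<Phi> pt_a)) / ereal h)
            \<longlongrightarrow> V_H_star 3) (at_right 0)
       \<and> V_H_star 3 \<ge> ereal ((8 * ln 3 - 4 * ln 2) / 9)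
       \<and> (8 * ln 3 - 4 * ln 2) / 9 > (0::real)
       \<and> V_K_star pt_a = 0"
proof -
  define \<kappa> where "\<kappa> = kappa \<tau>"
  have \<kappa>: "\<kappa> > 0" using assms(9) by (simp add: \<kappa>_def kappa_def)
  define \<psi> where "\<psi> = \<tau> * \<Phi> pt_a"
  have "\<Phi> pt_a = ln (norm pt_a) + b" using assms(6) norm_pt_a by simp
  then have \<psi>: "\<psi> = \<tau> * (ln 3 + b)" by (simp add: \<psi>_def norm_pt_a)
  obtain V where V: "V_H_star 3 = ereal V" "(8 * ln 3 - 4 * ln 2) / 9 \<le> V" by (rule V_H_star_real)
  define F where "F h = F_ext \<Phi> \<tau> (\<tau> + h) pt_a" for h
  have "0 < x \<Longrightarrow> x < y \<Longrightarrow> (8 * y - 4 * x) / 9 > 0" for x y :: real by simp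
  from this[of "ln 2" "ln 3"] have pos: "(8 * ln 3 - 4 * ln 2) / 9 > (0::real)" by simp
  have in_ball: "norm z \<le> 1 \<Longrightarrow> \<Phi> z \<le> b"
    and outside: "norm z \<ge> 1 \<Longrightarrow> \<Phi> z = ln (norm z) + b" and ge: "z \<noteq> 0 \<Longrightarrow> \<Phi> z \<ge> b + ln (norm z)" for z
    using assms(5-7) by blast+
  have upper: "F h \<le> ereal (\<psi> + h * V)" if "h > 0" for h
    unfolding F_def \<psi> by (rule F_ext_upper[OF in_ball outside assms(9) that V(1)])
  have lower: "ereal (\<psi> + h * V) \<le> F h" if "0 < h" "h \<le> \<kappa>" for h
    unfolding F_def \<psi>
    by (rule F_ext_lower[OF outside ge assms(9) that(1) that(2)[unfolded \<kappa>_def] V(1)])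
  have mono: "F h \<le> F h'" if "h \<le> h'" for h h'
    unfolding F_def F_ext_def using that by (intro usc_reg_mono extremal_mono_degree) simp
  \<comment> \<open>at \<open>h = 0\<close> the upper bound comes from \<open>h > 0\<close> by monotonicity, the lower one from \<open>\<tau> \<Phi>\<close> itself\<close>
  have F0: "F 0 = ereal \<psi>"
  proof (rule antisym)
    show "F 0 \<le> ereal \<psi>"
    proof (rule ereal_le_epsilon2)
      fix e :: real assume e: "e > 0"
      have Vpos: "V > 0" using pos V(2) by linarith
      then have "F (e / V) \<le> ereal (\<psi> + e / V * V)" using e by (intro upper) simp
      moreover have "F 0 \<le> F (e / V)" using e Vpos by (intro mono) simp
      ultimately show "F 0 \<le> ereal \<psi> + ereal e" using Vpos by simp
    qed
    have "(\<lambda>z. ereal \<tau> * ereal (\<Phi> z)) \<in> Lelong (\<tau> * 1)"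
      using assms(3,9) by (intro Lelong_cmult) (auto simp: Lelong_plus_def)
    then have "(\<lambda>z. ereal (\<tau> * \<Phi> z)) \<in> Lelong \<tau>" by simp
    then have "ereal (\<tau> * \<Phi> pt_a) \<le> extremal \<tau> set_K (\<lambda>p. \<tau> * \<Phi> p) pt_a"
      by (rule extremal_upper) simp
    also have "\<dots> \<le> F 0" unfolding F_def F_ext_def using usc_reg_ge by simp
    finally show "ereal \<psi> \<le> F 0" by (simp add: \<psi>_def)
  qed
  have eq: "F h = ereal (\<psi> + h * V)" if "0 \<le> h" "h \<le> \<kappa>" for h
    using F0 upper[of h] lower[of h] that by (cases "h = 0") (auto intro: antisym)
  have min: "ereal (min h \<kappa>) * ereal V \<le> F h - ereal \<psi> \<and> F h - ereal \<psi> \<le> ereal h * ereal V" if h: "h > 0" for h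
  proof -
    define m where "m = min h \<kappa>"
    have "ereal (\<psi> + m * V) \<le> F m" using h \<kappa> by (intro lower) (auto simp: m_def)
    also have "\<dots> \<le> F h" by (intro mono) (simp add: m_def)
    finally show ?thesis using upper[OF h] unfolding m_def[symmetric] by (cases "F h") auto
  qed
  have lim: "((\<lambda>h. (F h - ereal \<psi>) / ereal h) \<longlongrightarrow> ereal V) (at_right 0)"
  proof (rule tendsto_eventually)
    have "eventually (\<lambda>h. h \<in> {0<..<\<kappa>}) (at_right 0)" using \<kappa> by (rule eventually_at_right_real)
    then show "eventually (\<lambda>h. (F h - ereal \<psi>) / ereal h = ereal V) (at_right 0)"
      by eventually_elim (simp add: eq)
  qed
  show ?thesis
    unfolding F_def[symmetric] \<psi>_def[symmetric] \<kappa>_def[symmetric] V(1)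
  proof (intro conjI allI impI)
    show "F h = ereal \<psi> + ereal h * ereal V" if "0 \<le> h \<and> h \<le> \<kappa>" for h
      using eq that by simp
    show "ereal ((8 * ln 3 - 4 * ln 2) / 9) \<le> ereal V" using V(2) by (simp only: ereal_less_eq)
  qed (use min lim pos V_K_star_pt_a in blast)+
qed

end
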